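(* Let $k\ge 2$ and let $s_1,\ldots,s_{k-1}$ be positive integers. Then $$\mathrm{forb}(m,\{1_{k,1},\,I_{s_1}\times\cdots\times I_{s_{k-1}}\})=\binom m0+\cdots+\binom m{k-2}+ex^{(k-1)}(m,K(s_1,\ldots,s_{k-1})).$$ In particular, $$\mathrm{forb}(m,\{1_{3,1},F_{11}\})=1+m+ex(m,K_{2,2})=\Theta(m^{3/2})\quad (m\to\infty).$$
   Context: A matrix is simple if it is a $(0,1)$-matrix with no repeated columns. $F\prec A$ means that some submatrix of $A$ is a row and column permutation of $F$. For a family $\mathcal F$ of $(0,1)$-matrices, $\mathrm{forb}(m,\mathcal F)$ is the maximum number of columns of an $m$-rowed simple matrix $A$ with $F\nprec A$ for all $F\in\mathcal F$. $1_{k,1}$ is the $k\times 1$ column of $1$'s and $I_s$ the $s\times s$ identity matrix. $A_1\times\cdots\times A_p$ is the matrix whose columns are all combinations obtained by placing a column of $A_1$ on top of a column of $A_2$, on top of a column of $A_3$, etc. $K(s_1,\ldots,s_p)$ is the complete $p$-partite $p$-uniform hypergraph with partite sets of sizes $s_1,\ldots,s_p$ (edges are all sets with exactly one vertex in each partite set). $ex^{(p)}(m,\mathcal H)$ is the largest number of edges of a $p$-uniform hypergraph (no repeated edges) on $m$ vertices with no subhypergraph isomorphic to $\mathcal H$; $ex(m,G)$ is the graph version, and $K_{2,2}$ is the complete bipartite graph with parts of size $2$. Finally $$F_{11}=I_2\times I_2=\begin{bmatrix}1&0&1&0\\1&0&0&1\\0&1&1&0\\0&1&0&1\end{bmatrix}$$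 (equality up to row and column permutations). *)

theory Defs
  imports
    "Jordan_Normal_Form.DL_Submatrix"
    "HOL-Combinatorics.Permutations"
    "HOL-Library.Landau_Symbols"
begin

section \<open>Matrices and configurations\<close>

definition simple_mat :: "nat mat \<Rightarrow> bool" where
  "simple_mat A \<longleftrightarrow> elements_mat A \<subseteq> {0, 1} \<and> distinct (cols A)"

definition row_col_perm :: "nat mat \<Rightarrow> nat mat \<Rightarrow> bool" where
  "row_col_perm A F \<longleftrightarrow>
     (\<exists>p q. p permutes {..<dim_row F} \<and> q permutes {..<dim_col F} \<and>
        A = mat (dim_row F) (dim_col F) (\<lambda>(i, j). F $$ (p i, q j)))"

definition config :: "nat mat \<Rightarrow> nat mat \<Rightarrow> bool" (infix "\<prec>" 50) where
  "F \<prec> A \<longleftrightarrow>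
     (\<exists>I J. I \<subseteq> {..<dim_row A} \<and> J \<subseteq> {..<dim_col A} \<and> row_col_perm (submatrix A I J) F)"

text \<open>The set below is finite, since an \<open>m\<close>-rowed simple matrix has at most \<open>2 ^ m\<close> columns. It is
  nonempty if every member of the family has a column, because of the matrix without columns.\<close>

definition forb :: "nat \<Rightarrow> nat mat set \<Rightarrow> nat" where
  "forb m \<F> = Max {dim_col A | A. simple_mat A \<and> dim_row A = m \<and> (\<forall>F\<in>\<F>. \<not> F \<prec> A)}"

definition ones_mat :: "nat \<Rightarrow> nat \<Rightarrow> nat mat" where
  "ones_mat k l = mat k l (\<lambda>_. 1)"

text \<open>The product \<open>A \<times> B\<close>: column \<open>j\<close> is column \<open>j div dim_col B\<close> of \<open>A\<close> on top of column
  \<open>j mod dim_col B\<close> of \<open>B\<close>, so every pair of columns is used exactly once.\<close>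

definition mat_product :: "nat mat \<Rightarrow> nat mat \<Rightarrow> nat mat" where
  "mat_product A B =
     mat (dim_row A + dim_row B) (dim_col A * dim_col B)
       (\<lambda>(i, j). if i < dim_row A then A $$ (i, j div dim_col B)
                 else B $$ (i - dim_row A, j mod dim_col B))"

text \<open>The product of the empty list is the neutral element of \<open>mat_product\<close>: one column, no rows.\<close>

definition mat_product_list :: "nat mat list \<Rightarrow> nat mat" where
  "mat_product_list As = foldr mat_product As (mat 0 1 (\<lambda>_. 0))"

definition F11 :: "nat mat" where
  "F11 = mat_of_rows_list 4
     [[1, 0, 1, 0],
      [1, 0, 0, 1],
      [0, 1, 1, 0],
      [0, 1, 0, 1]]"

lemma mat_product_list_single: "mat_product_list [A] = A"
  by (rule eq_matI) (auto simp: mat_product_list_def mat_product_def)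

lemma F11_eq_product: "row_col_perm F11 (mat_product (1\<^sub>m 2) (1\<^sub>m 2))"
proof -
  define p :: "nat \<Rightarrow> nat" where
    "p = (\<lambda>i. if i = 1 then 2 else if i = 2 then 3 else if i = 3 then 1 else i)"
  define q :: "nat \<Rightarrow> nat" where
    "q = (\<lambda>i. if i = 1 then 3 else if i = 2 then 1 else if i = 3 then 2 else i)"
  have four: "{..<4::nat} = {0, 1, 2, 3}" by auto
  have p: "p permutes {..<4}"
    by (rule bij_imp_permutes) (auto simp: four p_def bij_betw_def)
  have q: "q permutes {..<4}"
    by (rule bij_imp_permutes) (auto simp: four q_def bij_betw_def)
  have "F11 = mat 4 4 (\<lambda>(i, j). mat_product (1\<^sub>m 2) (1\<^sub>m 2) $$ (p i, q j))"
  proof (rule eq_matI; simp)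
    fix i j :: nat
    assume ij: "i < 4" "j < 4"
    from ij have "i \<in> {0, 1, 2, 3}" "j \<in> {0, 1, 2, 3}" by auto
    then show "F11 $$ (i, j) = mat_product (1\<^sub>m 2) (1\<^sub>m 2) $$ (p i, q j)"
      by (auto simp: F11_def mat_of_rows_list_def mat_product_def p_def q_def)
  qed (simp_all add: F11_def mat_of_rows_list_def)
  with p q show ?thesis
    unfolding row_col_perm_def by (auto simp: mat_product_def)
qed

section \<open>Hypergraphs\<close>

type_synonym 'a hypergraph = "'a set \<times> 'a set set"

definition uniform_hypergraph :: "nat \<Rightarrow> 'a hypergraph \<Rightarrow> bool" where
  "uniform_hypergraph p G \<longleftrightarrow> finite (fst G) \<and> (\<forall>e\<in>snd G. e \<subseteq> fst G \<and> card e = p)"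

definition subhypergraph :: "'a hypergraph \<Rightarrow> 'a hypergraph \<Rightarrow> bool" where
  "subhypergraph H G \<longleftrightarrow> fst H \<subseteq> fst G \<and> snd H \<subseteq> snd G \<and> (\<forall>e\<in>snd H. e \<subseteq> fst H)"

definition hypergraph_iso :: "'a hypergraph \<Rightarrow> 'b hypergraph \<Rightarrow> bool" where
  "hypergraph_iso H G \<longleftrightarrow> (\<exists>f. bij_betw f (fst H) (fst G) \<and> snd G = (\<lambda>e. f ` e) ` snd H)"

text \<open>Hypergraphs on \<open>m\<close> vertices are taken on the vertex set \<open>{..<m}\<close>; up to isomorphism these
  are all of them.\<close>

definition ex_hyper :: "nat \<Rightarrow> nat \<Rightarrow> 'a hypergraph \<Rightarrow> nat" where
  "ex_hyper p m H =
     Max {card E | E. uniform_hypergraph p ({..<m}, E) \<and>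
                      \<not> (\<exists>H'. subhypergraph H' ({..<m}, E) \<and> hypergraph_iso H' H)}"

text \<open>Part \<open>i\<close> of the complete multipartite hypergraph consists of the pairs \<open>(i, j)\<close> with
  \<open>j < s ! i\<close>.\<close>

definition complete_multipartite :: "nat list \<Rightarrow> (nat \<times> nat) hypergraph" where
  "complete_multipartite s =
     (let V = (SIGMA i:{..<length s}. {..<s ! i})
      in (V, {e. e \<subseteq> V \<and> (\<forall>i<length s. \<exists>!v. v \<in> e \<and> v \<in> {i} \<times> {..<s ! i})}))"

text \<open>Graphs are the \<open>2\<close>-uniform hypergraphs.\<close>

definition ex_graph :: "nat \<Rightarrow> 'a hypergraph \<Rightarrow> nat" where
  "ex_graph m G = ex_hyper 2 m G"

definition complete_bipartite :: "nat \<Rightarrow> nat \<Rightarrow> (nat + nat) hypergraph" where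
  "complete_bipartite a b = ({..<a} <+> {..<b}, {{Inl i, Inr j} | i j. i < a \<and> j < b})"

end

theory Submission
  imports
    Defs
    "HOL-Algebra.Algebraic_Closure_Type"
    "HOL-Analysis.Convex"
    "HOL-Library.Z2"
begin

text \<open>Read the columns of a simple matrix as a set system. Avoiding \<open>1\<^bsub>k,1\<^esub>\<close> means that all sets
  have at most \<open>k - 1\<close> elements. The product of the identity matrices is the incidence matrix of
  \<open>K(s\<^sub>1, \<dots>, s\<^bsub>k-1\<^esub>)\<close>, whose edges have exactly \<open>k - 1\<close> vertices; so a copy of it in the matrix is a
  copy of the hypergraph among the sets of size \<open>k - 1\<close>, and the smaller sets are unrestricted.

  For the growth rate, a \<open>K\<^bsub>2,2\<^esub>\<close>-free graph has few edges because two vertices have at most one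
  common neighbour, and the incidence graph of points and non-vertical lines of the affine plane
  over the field with \<open>2 ^ n\<close> elements is \<open>K\<^bsub>2,2\<^esub>\<close>-free with \<open>2 ^ (3 * n)\<close> edges on
  \<open>2 * 4 ^ n\<close> vertices. The values \<open>2 * 4 ^ n\<close> are dense enough to cover all \<open>m\<close>.\<close>

section \<open>Set systems and incidence matrices\<close>

text \<open>Copies in the sense of \<open>ex_hyper\<close>, with the map running from
  \<open>H\<close> into \<open>G\<close>. They need not be induced: \<open>G\<close> may have
  further edges inside the image.\<close>

definition embeds :: "'a hypergraph \<Rightarrow> 'b hypergraph \<Rightarrow> bool" where
  "embeds H G \<longleftrightarrow>
     (\<exists>f. inj_on f (fst H) \<and> f ` fst H \<subseteq> fst G \<and> (`) f ` snd H \<subseteq> snd G)"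

text \<open>The set-system form of \<open>F \<prec> A\<close>: \<open>f\<close> selects rows and
  \<open>g\<close> selects columns. The set \<open>g e\<close> is compared with \<open>e\<close>
  only on the image of \<open>f\<close> and may contain any other elements.\<close>

definition has_trace :: "'a hypergraph \<Rightarrow> 'b hypergraph \<Rightarrow> bool" where
  "has_trace H G \<longleftrightarrow>
     (\<exists>f g. inj_on f (fst H) \<and> f ` fst H \<subseteq> fst G \<and> inj_on g (snd H) \<and> g ` snd H \<subseteq> snd G \<and>
        (\<forall>v\<in>fst H. \<forall>e\<in>snd H. f v \<in> g e \<longleftrightarrow> v \<in> e))"

text \<open>The bijections label rows by vertices and columns by edges in any order, so the relation
  is blind to row and column permutations, and different columns always carry different
  edges.\<close>

definition incidence_mat :: "nat mat \<Rightarrow> 'a hypergraph \<Rightarrow> bool" where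
  "incidence_mat A G \<longleftrightarrow>
     (\<exists>\<rho> \<gamma>. bij_betw \<rho> {..<dim_row A} (fst G) \<and> bij_betw \<gamma> {..<dim_col A} (snd G) \<and>
        (\<forall>i<dim_row A. \<forall>j<dim_col A. A $$ (i, j) = of_bool (\<rho> i \<in> \<gamma> j)))"

text \<open>\<open>hypergraph_iso\<close> maps the copy onto \<open>H\<close>, so its inverse is the
  embedding. Conversely the image of \<open>H\<close> is the copy; since edges lie inside the vertex
  set, it is a subhypergraph and the inverse cancels on every edge.\<close>

lemma copy_iff_embeds:
  assumes "\<forall>e\<in>snd H. e \<subseteq> fst H"
  shows "(\<exists>H'. subhypergraph H' G \<and> hypergraph_iso H' H) \<longleftrightarrow> embeds H G"
proof
  assume "\<exists>H'. subhypergraph H' G \<and> hypergraph_iso H' H"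
  then obtain H' f where H': "fst H' \<subseteq> fst G" "snd H' \<subseteq> snd G" "\<forall>e\<in>snd H'. e \<subseteq> fst H'"
    and f: "bij_betw f (fst H') (fst H)" and snd_H: "snd H = (\<lambda>e. f ` e) ` snd H'"
    unfolding subhypergraph_def hypergraph_iso_def by (elim exE conjE) (rule that, assumption+)
  define g where "g = inv_into (fst H') f"
  have g: "bij_betw g (fst H) (fst H')"
    unfolding g_def by (rule bij_betw_inv_into[OF f])
  have gf: "g ` f ` e = e" if "e \<in> snd H'" for e
  proof -
    have "e \<subseteq> fst H'" using H'(3) that by blast
    then show ?thesis
      using inv_into_image_cancel[of f "fst H'" e] f unfolding g_def bij_betw_def by simp
  qed
  have "(`) g ` snd H \<subseteq> snd G"
    using gf H'(2) by (auto simp: snd_H)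
  moreover have "inj_on g (fst H)" "g ` fst H \<subseteq> fst G"
    using g H'(1) by (auto simp: bij_betw_def)
  ultimately show "embeds H G"
    unfolding embeds_def by blast
next
  assume "embeds H G"
  then obtain f where f: "inj_on f (fst H)" "f ` fst H \<subseteq> fst G" "(`) f ` snd H \<subseteq> snd G"
    unfolding embeds_def by blast
  define H' where "H' = (f ` fst H, (`) f ` snd H)"
  have "subhypergraph H' G"
    using f assms by (simp add: subhypergraph_def H'_def) blast
  moreover have "hypergraph_iso H' H"
  proof -
    have "bij_betw (inv_into (fst H) f) (fst H') (fst H)"
      using f(1) by (simp add: H'_def bij_betw_inv_into inj_on_imp_bij_betw)
    moreover have "(\<lambda>e. inv_into (fst H) f ` e) ` snd H' = (\<lambda>e. e) ` snd H"
      unfolding H'_def snd_conv image_image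
      by (rule image_cong) (use f(1) assms in \<open>auto simp: image_image subset_iff\<close>)
    ultimately show ?thesis
      unfolding hypergraph_iso_def by (metis image_ident)
  qed
  ultimately show "\<exists>H'. subhypergraph H' G \<and> hypergraph_iso H' H" by blast
qed

section \<open>Configurations of matrices as traces of set systems\<close>

lemma bij_betw_pick:
  assumes "finite I"
  shows "bij_betw (pick I) {..<card I} I"
proof -
  have "inj_on (pick I) {..<card I}"
    by (rule linorder_inj_onI) (auto dest: pick_mono_le)
  moreover have "pick I ` {..<card I} \<subseteq> I"
    using pick_in_set_le by auto
  ultimately show ?thesis
    using assms by (simp add: bij_betw_def card_image card_subset_eq)
qed

text \<open>\<open>submatrix\<close> lists the selected indices in increasing order, which is the
  order of \<open>pick\<close>. Any other enumeration \<open>f\<close> of the same set differs from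
  it by a permutation.\<close>

lemma ex_permutes_pick:
  assumes "inj_on f {..<r}"
  obtains p where "p permutes {..<r}" "\<And>i. i < r \<Longrightarrow> f (p i) = pick (f ` {..<r}) i"
proof -
  let ?I = "f ` {..<r}"
  have card_I: "card ?I = r"
    using assms by (simp add: card_image)
  have f: "bij_betw f {..<r} ?I"
    using assms by (simp add: inj_on_imp_bij_betw)
  have pick: "bij_betw (pick ?I) {..<r} ?I"
    using bij_betw_pick[of ?I] card_I by simp
  define p where "p i = (if i < r then inv_into {..<r} f (pick ?I i) else i)" for i
  have "bij_betw (inv_into {..<r} f \<circ> pick ?I) {..<r} {..<r}"
    using pick bij_betw_inv_into[OF f] by (rule bij_betw_trans)
  then have "bij_betw p {..<r} {..<r}"
    by (rule bij_betw_cong[THEN iffD1, rotated]) (simp add: p_def)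
  then have "p permutes {..<r}"
    by (rule bij_imp_permutes) (simp add: p_def)
  moreover have "f (p i) = pick ?I i" if "i < r" for i
    using that pick by (auto simp: p_def bij_betw_def intro!: f_inv_into_f)
  ultimately show thesis by (rule that)
qed

text \<open>Choosing index sets and then permuting rows and columns amounts to choosing the indices
  in a prescribed order, so submatrices and permutations are replaced by two injections.\<close>

lemma config_iff:
  "F \<prec> A \<longleftrightarrow>
     (\<exists>f g. inj_on f {..<dim_row F} \<and> f ` {..<dim_row F} \<subseteq> {..<dim_row A} \<and>
        inj_on g {..<dim_col F} \<and> g ` {..<dim_col F} \<subseteq> {..<dim_col A} \<and>
        (\<forall>i<dim_row F. \<forall>j<dim_col F. A $$ (f i, g j) = F $$ (i, j)))"
  (is "_ \<longleftrightarrow> ?R")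
proof
  assume "F \<prec> A"
  then obtain I J p q where I: "I \<subseteq> {..<dim_row A}" and J: "J \<subseteq> {..<dim_col A}"
    and p: "p permutes {..<dim_row F}" and q: "q permutes {..<dim_col F}"
    and sub: "submatrix A I J = mat (dim_row F) (dim_col F) (\<lambda>(i, j). F $$ (p i, q j))"
    unfolding config_def row_col_perm_def by blast
  have I': "{i. i < dim_row A \<and> i \<in> I} = I" and J': "{i. i < dim_col A \<and> i \<in> J} = J"
    using I J by auto
  have card_I: "card I = dim_row F" and card_J: "card J = dim_col F"
    using arg_cong[OF sub, of dim_row] arg_cong[OF sub, of dim_col]
    by (simp_all add: submatrix_def I' J')
  have pick_I: "bij_betw (pick I) {..<dim_row F} I" and pick_J: "bij_betw (pick J) {..<dim_col F} J"
    using bij_betw_pick[of I] bij_betw_pick[of J] I J card_I card_J finite_subset by auto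
  \<comment> \<open>The permutations act on the indices of \<open>F\<close>, so their inverses turn
    the increasing enumerations \<open>pick I\<close> and \<open>pick J\<close> into maps from
    \<open>F\<close> to \<open>A\<close>.\<close>
  define p' where "p' = inv_into {..<dim_row F} p"
  define q' where "q' = inv_into {..<dim_col F} q"
  have p': "bij_betw p' {..<dim_row F} {..<dim_row F}" "\<And>i. i < dim_row F \<Longrightarrow> p (p' i) = i"
    using permutes_imp_bij[OF p] bij_betw_inv_into bij_betw_inv_into_right unfolding p'_def by fastforce+
  have q': "bij_betw q' {..<dim_col F} {..<dim_col F}" "\<And>i. i < dim_col F \<Longrightarrow> q (q' i) = i"
    using permutes_imp_bij[OF q] bij_betw_inv_into bij_betw_inv_into_right unfolding q'_def by fastforce+
  have f: "bij_betw (pick I \<circ> p') {..<dim_row F} I"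
    and g: "bij_betw (pick J \<circ> q') {..<dim_col F} J"
    using bij_betw_trans[OF p'(1) pick_I] bij_betw_trans[OF q'(1) pick_J] .
  have "A $$ ((pick I \<circ> p') i, (pick J \<circ> q') j) = F $$ (i, j)"
    if "i < dim_row F" "j < dim_col F" for i j
  proof -
    have "p' i < dim_row F" "q' j < dim_col F"
      using p'(1) q'(1) that by (auto simp: bij_betw_def)
    then show ?thesis
      using arg_cong[OF sub, of "\<lambda>M. M $$ (p' i, q' j)"] that p'(2) q'(2)
      by (simp add: submatrix_def I' J' card_I card_J)
  qed
  then show ?R
    using f g I J by (intro exI[of _ "pick I \<circ> p'"] exI[of _ "pick J \<circ> q'"])
      (simp add: bij_betw_def)
next
  assume ?R
  then obtain f g where f: "inj_on f {..<dim_row F}" "f ` {..<dim_row F} \<subseteq> {..<dim_row A}"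
    and g: "inj_on g {..<dim_col F}" "g ` {..<dim_col F} \<subseteq> {..<dim_col A}"
    and A: "\<And>i j. i < dim_row F \<Longrightarrow> j < dim_col F \<Longrightarrow> A $$ (f i, g j) = F $$ (i, j)"
    by (elim exE conjE) (rule that, assumption+, simp)
  let ?I = "f ` {..<dim_row F}" and ?J = "g ` {..<dim_col F}"
  obtain p where p: "p permutes {..<dim_row F}" "\<And>i. i < dim_row F \<Longrightarrow> f (p i) = pick ?I i"
    using ex_permutes_pick[OF f(1)] by blast
  obtain q where q: "q permutes {..<dim_col F}" "\<And>i. i < dim_col F \<Longrightarrow> g (q i) = pick ?J i"
    using ex_permutes_pick[OF g(1)] by blast
  have I': "{i. i < dim_row A \<and> i \<in> ?I} = ?I" and J': "{i. i < dim_col A \<and> i \<in> ?J} = ?J"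
    using f(2) g(2) by auto
  have card_I: "card ?I = dim_row F" and card_J: "card ?J = dim_col F"
    using f(1) g(1) by (simp_all add: card_image)
  have "submatrix A ?I ?J = mat (dim_row F) (dim_col F) (\<lambda>(i, j). F $$ (p i, q j))"
  proof (rule eq_matI)
    fix i j
    assume "i < dim_row (mat (dim_row F) (dim_col F) (\<lambda>(i, j). F $$ (p i, q j)))"
      "j < dim_col (mat (dim_row F) (dim_col F) (\<lambda>(i, j). F $$ (p i, q j)))"
    then have ij: "i < dim_row F" "j < dim_col F" by auto
    then have "p i < dim_row F" "q j < dim_col F"
      using permutes_in_image[OF p(1)] permutes_in_image[OF q(1)] by auto
    then show "submatrix A ?I ?J $$ (i, j) = mat (dim_row F) (dim_col F) (\<lambda>(i, j). F $$ (p i, q j)) $$ (i, j)"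
      using A[of "p i" "q j"] ij p(2) q(2) by (simp add: submatrix_def I' J' card_I card_J)
  qed (simp_all add: submatrix_def I' J' card_I card_J)
  then show "F \<prec> A"
    using f(2) g(2) p(1) q(1) unfolding config_def row_col_perm_def by blast
qed

text \<open>Index maps and label maps correspond by conjugation with the labellings, and the entries
  of both matrices are membership bits.\<close>

lemma config_iff_has_trace:
  assumes "incidence_mat F H" "incidence_mat A G"
  shows "F \<prec> A \<longleftrightarrow> has_trace H G"
proof -
  obtain \<rho> \<gamma> where \<rho>: "bij_betw \<rho> {..<dim_row F} (fst H)" and \<gamma>: "bij_betw \<gamma> {..<dim_col F} (snd H)"
    and F: "\<And>i j. i < dim_row F \<Longrightarrow> j < dim_col F \<Longrightarrow> F $$ (i, j) = of_bool (\<rho> i \<in> \<gamma> j)"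
    using assms(1) unfolding incidence_mat_def by blast
  obtain \<rho>' \<gamma>' where \<rho>': "bij_betw \<rho>' {..<dim_row A} (fst G)" and \<gamma>': "bij_betw \<gamma>' {..<dim_col A} (snd G)"
    and A: "\<And>i j. i < dim_row A \<Longrightarrow> j < dim_col A \<Longrightarrow> A $$ (i, j) = of_bool (\<rho>' i \<in> \<gamma>' j)"
    using assms(2) unfolding incidence_mat_def by blast
  show ?thesis
  proof
    assume "F \<prec> A"
    then obtain f g where f: "inj_on f {..<dim_row F}" "f ` {..<dim_row F} \<subseteq> {..<dim_row A}"
      and g: "inj_on g {..<dim_col F}" "g ` {..<dim_col F} \<subseteq> {..<dim_col A}"
      and fg: "\<And>i j. i < dim_row F \<Longrightarrow> j < dim_col F \<Longrightarrow> A $$ (f i, g j) = F $$ (i, j)"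
      unfolding config_iff by (elim exE conjE) (rule that, assumption+, simp)
    \<comment> \<open>Stated generally to serve rows and columns alike: go back along
      \<open>\<alpha>\<close>, apply \<open>h\<close>, and go out along
      \<open>\<beta>\<close>.\<close>
    have lift: "inj_on (\<beta> \<circ> (h \<circ> inv_into S \<alpha>)) Y \<and> (\<beta> \<circ> (h \<circ> inv_into S \<alpha>)) ` Y \<subseteq> W"
      if "bij_betw \<alpha> S Y" "bij_betw \<beta> Z W" "inj_on h S" "h ` S \<subseteq> Z"
      for S :: "nat set" and Z :: "nat set" and h :: "nat \<Rightarrow> nat" and \<alpha> :: "nat \<Rightarrow> 'x" and \<beta> :: "nat \<Rightarrow> 'y" and Y W
    proof -
      have "bij_betw (inv_into S \<alpha>) Y S"
        by (rule bij_betw_inv_into[OF that(1)])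
      then have "inj_on (inv_into S \<alpha>) Y" "inv_into S \<alpha> ` Y = S"
        by (auto simp: bij_betw_def)
      moreover have "inj_on \<beta> (h ` S)"
        using that(2,4) by (meson bij_betw_imp_inj_on inj_on_subset)
      moreover have "\<beta> ` Z = W"
        using that(2) by (simp add: bij_betw_def)
      ultimately show ?thesis
        using that(3,4) by (auto intro!: comp_inj_on simp flip: image_image)
    qed
    define f' where "f' = \<rho>' \<circ> (f \<circ> inv_into {..<dim_row F} \<rho>)"
    define g' where "g' = \<gamma>' \<circ> (g \<circ> inv_into {..<dim_col F} \<gamma>)"
    have f': "inj_on f' (fst H)" "f' ` fst H \<subseteq> fst G"
      using lift[OF \<rho> \<rho>' f] unfolding f'_def by simp_all
    have g': "inj_on g' (snd H)" "g' ` snd H \<subseteq> snd G"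
      using lift[OF \<gamma> \<gamma>' g] unfolding g'_def by simp_all
    have mem: "f' v \<in> g' e \<longleftrightarrow> v \<in> e"
      if v: "v \<in> fst H" and e: "e \<in> snd H" for v e
    proof -
      obtain i where i: "i < dim_row F" "v = \<rho> i"
        using v by (auto simp flip: bij_betw_imp_surj_on[OF \<rho>])
      obtain j where j: "j < dim_col F" "e = \<gamma> j"
        using e by (auto simp flip: bij_betw_imp_surj_on[OF \<gamma>])
      have "f i < dim_row A" "g j < dim_col A"
        using f(2) g(2) i j by auto
      then have "(of_bool (\<rho>' (f i) \<in> \<gamma>' (g j)) :: nat) = of_bool (\<rho> i \<in> \<gamma> j)"
        using fg[OF i(1) j(1)] F[OF i(1) j(1)] A[of "f i" "g j"] by metis
      then have "\<rho>' (f i) \<in> \<gamma>' (g j) \<longleftrightarrow> \<rho> i \<in> \<gamma> j"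
        by (rule of_bool_eq_iff[THEN iffD1])
      then show ?thesis
        using i j \<rho> \<gamma> by (simp add: f'_def g'_def bij_betw_def inv_into_f_f)
    qed
    show "has_trace H G"
      unfolding has_trace_def by (intro exI[of _ f'] exI[of _ g'] conjI ballI f' g' mem)
  next
    assume "has_trace H G"
    then obtain f g where f: "inj_on f (fst H)" "f ` fst H \<subseteq> fst G"
      and g: "inj_on g (snd H)" "g ` snd H \<subseteq> snd G"
      and fg: "\<And>v e. v \<in> fst H \<Longrightarrow> e \<in> snd H \<Longrightarrow> f v \<in> g e \<longleftrightarrow> v \<in> e"
      unfolding has_trace_def by (elim exE conjE) (rule that, assumption+, simp)
    have lift: "inj_on (inv_into Z \<beta> \<circ> (h \<circ> \<alpha>)) S \<and> (inv_into Z \<beta> \<circ> (h \<circ> \<alpha>)) ` S \<subseteq> Z \<and>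
        (\<forall>x\<in>S. \<beta> ((inv_into Z \<beta> \<circ> (h \<circ> \<alpha>)) x) = h (\<alpha> x))"
      if "bij_betw \<alpha> S Y" "bij_betw \<beta> Z W" "inj_on h Y" "h ` Y \<subseteq> W"
      for S :: "nat set" and Z :: "nat set" and h :: "'x \<Rightarrow> 'y" and \<alpha> :: "nat \<Rightarrow> 'x" and \<beta> :: "nat \<Rightarrow> 'y" and Y W
    proof -
      have \<beta>: "bij_betw (inv_into Z \<beta>) W Z"
        by (rule bij_betw_inv_into[OF that(2)])
      then have "inj_on (inv_into Z \<beta>) (h ` Y)"
        using that(4) by (meson bij_betw_imp_inj_on inj_on_subset)
      moreover have "\<alpha> ` S = Y" "inj_on \<alpha> S"
        using that(1) by (simp_all add: bij_betw_def)
      ultimately have "inj_on (inv_into Z \<beta> \<circ> (h \<circ> \<alpha>)) S"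
        using that(3) by (intro comp_inj_on) (simp_all flip: image_image)
      moreover have hx: "h (\<alpha> x) \<in> W" if "x \<in> S" for x
        using that \<open>bij_betw \<alpha> S Y\<close> \<open>h ` Y \<subseteq> W\<close> by (auto simp: bij_betw_def)
      ultimately show ?thesis
        using \<beta> that(2) by (auto simp: bij_betw_def f_inv_into_f)
    qed
    define f' where "f' = inv_into {..<dim_row A} \<rho>' \<circ> (f \<circ> \<rho>)"
    define g' where "g' = inv_into {..<dim_col A} \<gamma>' \<circ> (g \<circ> \<gamma>)"
    have f': "inj_on f' {..<dim_row F}" "f' ` {..<dim_row F} \<subseteq> {..<dim_row A}"
      "\<And>i. i < dim_row F \<Longrightarrow> \<rho>' (f' i) = f (\<rho> i)"
      using lift[OF \<rho> \<rho>' f] unfolding f'_def by blast+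
    have g': "inj_on g' {..<dim_col F}" "g' ` {..<dim_col F} \<subseteq> {..<dim_col A}"
      "\<And>i. i < dim_col F \<Longrightarrow> \<gamma>' (g' i) = g (\<gamma> i)"
      using lift[OF \<gamma> \<gamma>' g] unfolding g'_def by blast+
    have "A $$ (f' i, g' j) = F $$ (i, j)" if "i < dim_row F" "j < dim_col F" for i j
    proof -
      have "f' i < dim_row A" "g' j < dim_col A"
        using f'(2) g'(2) that by auto
      moreover have "\<rho> i \<in> fst H" "\<gamma> j \<in> snd H"
        using \<rho> \<gamma> that by (auto simp: bij_betw_def)
      ultimately show ?thesis
        using A F that fg f'(3) g'(3) by simp
    qed
    then show "F \<prec> A"
      using f' g' unfolding config_iff by blast
  qed
qed

lemma incidence_mat_dim_col:
  assumes "incidence_mat A G"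
  shows "dim_col A = card (snd G)"
  using assms unfolding incidence_mat_def by (metis bij_betw_same_card card_lessThan)

text \<open>Each column is replaced by its support. With entries \<open>0\<close> and
  \<open>1\<close> the support determines the column, so distinct columns give distinct
  sets.\<close>

lemma incidence_mat_of_simple_mat:
  assumes "simple_mat A"
  obtains \<S> where "\<S> \<subseteq> Pow {..<dim_row A}" "incidence_mat A ({..<dim_row A}, \<S>)"
proof -
  define \<gamma> where "\<gamma> j = {i. i < dim_row A \<and> A $$ (i, j) = 1}" for j
  have entries: "A $$ (i, j) = of_bool (i \<in> \<gamma> j)" if "i < dim_row A" "j < dim_col A" for i j
  proof -
    have "A $$ (i, j) \<in> elements_mat A"
      using that by (intro elements_matI[OF carrier_matI]) auto
    then have "A $$ (i, j) = 0 \<or> A $$ (i, j) = 1"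
      using assms unfolding simple_mat_def by blast
    then show ?thesis
      using that by (auto simp: \<gamma>_def)
  qed
  have "inj_on \<gamma> {..<dim_col A}"
  proof (rule inj_onI)
    fix j j' assume j: "j \<in> {..<dim_col A}" "j' \<in> {..<dim_col A}" and "\<gamma> j = \<gamma> j'"
    then have "col A j = col A j'"
      by (intro eq_vecI) (auto simp: entries)
    then have "cols A ! j = cols A ! j'"
      using j by simp
    then show "j = j'"
      using assms j unfolding simple_mat_def by (metis cols_length lessThan_iff nth_eq_iff_index_eq)
  qed
  then have "incidence_mat A ({..<dim_row A}, \<gamma> ` {..<dim_col A})"
    unfolding incidence_mat_def using entries
    by (intro exI[of _ id] exI[of _ \<gamma>]) (auto simp: inj_on_imp_bij_betw)
  moreover have "\<gamma> ` {..<dim_col A} \<subseteq> Pow {..<dim_row A}"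
    by (auto simp: \<gamma>_def)
  ultimately show thesis by (rule that[rotated])
qed

lemma ex_simple_incidence_mat:
  assumes "\<S> \<subseteq> Pow {..<m}"
  obtains A where "simple_mat A" "dim_row A = m" "incidence_mat A ({..<m}, \<S>)"
proof -
  have "finite \<S>"
    using assms finite_subset by blast
  then obtain \<gamma> where \<gamma>: "bij_betw \<gamma> {..<card \<S>} \<S>"
    using ex_bij_betw_nat_finite[of \<S>] by (auto simp: atLeast0LessThan)
  define A :: "nat mat" where "A = mat m (card \<S>) (\<lambda>(i, j). of_bool (i \<in> \<gamma> j))"
  have "distinct (cols A)"
  proof (subst distinct_conv_nth, intro allI impI)
    fix j j' assume "j < length (cols A)" "j' < length (cols A)" "j \<noteq> j'"
    then have j: "j < card \<S>" "j' < card \<S>" "j \<noteq> j'"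
      by (simp_all add: A_def)
    then have "\<gamma> j \<noteq> \<gamma> j'" "\<gamma> j \<subseteq> {..<m}" "\<gamma> j' \<subseteq> {..<m}"
      using \<gamma> assms by (auto simp: bij_betw_def inj_on_eq_iff)
    then obtain i where "i < m" "(i \<in> \<gamma> j) \<noteq> (i \<in> \<gamma> j')" by blast
    then have "col A j $ i \<noteq> col A j' $ i"
      using j by (simp add: A_def)
    then show "cols A ! j \<noteq> cols A ! j'"
      using j by (auto simp: A_def)
  qed
  moreover have "elements_mat A \<subseteq> {0, 1}"
    by (auto simp: A_def dest!: elements_matD)
  ultimately have "simple_mat A" by (simp add: simple_mat_def)
  moreover have "incidence_mat A ({..<m}, \<S>)"
    unfolding incidence_mat_def using \<gamma>
    by (intro exI[of _ id] exI[of _ \<gamma>]) (auto simp: A_def)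
  ultimately show thesis
    using that by (simp add: A_def)
qed

text \<open>Simple matrices with \<open>m\<close> rows and families of subsets of
  \<open>{..<m}\<close> translate into each other with the same size, so both maxima range over the
  same set of numbers.\<close>

lemma forb_eq_Max_traces:
  assumes "incidence_mat F H" "incidence_mat F' H'"
  shows "forb m {F, F'} = Max {card \<S> | \<S>. \<S> \<subseteq> Pow {..<m} \<and>
           \<not> has_trace H ({..<m}, \<S>) \<and> \<not> has_trace H' ({..<m}, \<S>)}"
proof -
  have "{dim_col A | A. simple_mat A \<and> dim_row A = m \<and> (\<forall>B\<in>{F, F'}. \<not> B \<prec> A)} =
     {card \<S> | \<S>. \<S> \<subseteq> Pow {..<m} \<and> \<not> has_trace H ({..<m}, \<S>) \<and> \<not> has_trace H' ({..<m}, \<S>)}"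
    (is "?L = ?R")
  proof (intro equalityI subsetI)
    fix n assume "n \<in> ?L"
    then obtain A where A: "n = dim_col A" "simple_mat A" "dim_row A = m" "\<not> F \<prec> A" "\<not> F' \<prec> A"
      by blast
    obtain \<S> where \<S>: "\<S> \<subseteq> Pow {..<m}" "incidence_mat A ({..<m}, \<S>)"
      using incidence_mat_of_simple_mat[OF A(2)] A(3) by blast
    have "n = card \<S>"
      using incidence_mat_dim_col[OF \<S>(2)] A(1) by simp
    moreover have "\<not> has_trace H ({..<m}, \<S>)" "\<not> has_trace H' ({..<m}, \<S>)"
      using A(4,5) \<S>(2) config_iff_has_trace assms by blast+
    ultimately show "n \<in> ?R"
      using \<S>(1) by blast
  next
    fix n assume "n \<in> ?R"
    then obtain \<S> where \<S>: "n = card \<S>" "\<S> \<subseteq> Pow {..<m}" "\<not> has_trace H ({..<m}, \<S>)"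
      "\<not> has_trace H' ({..<m}, \<S>)" by blast
    obtain A where A: "simple_mat A" "dim_row A = m" "incidence_mat A ({..<m}, \<S>)"
      using ex_simple_incidence_mat[OF \<S>(2)] by blast
    have "n = dim_col A"
      using incidence_mat_dim_col[OF A(3)] \<S>(1) by simp
    moreover have "\<forall>B\<in>{F, F'}. \<not> B \<prec> A"
      using \<S>(3,4) config_iff_has_trace[OF assms(1) A(3)] config_iff_has_trace[OF assms(2) A(3)]
      by simp
    ultimately show "n \<in> ?L"
      using A by blast
  qed
  then show ?thesis
    unfolding forb_def by simp
qed

section \<open>Families of sets of bounded size\<close>

text \<open>A trace satisfies \<open>f\<close> followed by inclusion: the image of \<open>e\<close>
  under \<open>f\<close> has \<open>r\<close> elements and lies in \<open>g e\<close>, which has at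
  most \<open>r\<close>, so the two are equal. Conversely, taking images under \<open>f\<close>
  serves as \<open>g\<close>.\<close>

lemma has_trace_iff_embeds:
  assumes H: "uniform_hypergraph r H" and W: "finite W"
    and \<S>: "\<S> \<subseteq> Pow W" "\<And>S. S \<in> \<S> \<Longrightarrow> card S \<le> r"
  shows "has_trace H (W, \<S>) \<longleftrightarrow> embeds H (W, {S \<in> \<S>. card S = r})"
proof
  assume "has_trace H (W, \<S>)"
  then obtain f g where f: "inj_on f (fst H)" "f ` fst H \<subseteq> W"
    and g: "g ` snd H \<subseteq> \<S>"
    and fg: "\<And>v e. v \<in> fst H \<Longrightarrow> e \<in> snd H \<Longrightarrow> f v \<in> g e \<longleftrightarrow> v \<in> e"
    unfolding has_trace_def by auto
  have "f ` e \<in> \<S> \<and> card (f ` e) = r" if e: "e \<in> snd H" for e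
  proof -
    have "e \<subseteq> fst H" "card e = r"
      using H e by (auto simp: uniform_hypergraph_def)
    then have "card (f ` e) = r"
      using f(1) by (metis card_image inj_on_subset)
    moreover have "f ` e \<subseteq> g e"
      using fg e \<open>e \<subseteq> fst H\<close> by blast
    moreover have "g e \<in> \<S>" using g e by blast
    moreover from this have "finite (g e)" "card (g e) \<le> r"
      using \<S> W by (auto intro: finite_subset)
    ultimately show ?thesis
      by (metis card_seteq)
  qed
  then show "embeds H (W, {S \<in> \<S>. card S = r})"
    unfolding embeds_def using f by auto
next
  assume "embeds H (W, {S \<in> \<S>. card S = r})"
  then obtain f where f: "inj_on f (fst H)" "f ` fst H \<subseteq> W" "(`) f ` snd H \<subseteq> {S \<in> \<S>. card S = r}"
    unfolding embeds_def by auto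
  have sub: "e \<subseteq> fst H" if "e \<in> snd H" for e
    using H that by (auto simp: uniform_hypergraph_def)
  have "inj_on ((`) f) (snd H)"
    using f(1) sub by (meson inj_onI inj_on_image_eq_iff)
  moreover have "f v \<in> f ` e \<longleftrightarrow> v \<in> e" if "v \<in> fst H" "e \<in> snd H" for v e
    using inj_on_image_mem_iff[OF f(1) that(1) sub[OF that(2)]] .
  ultimately show "has_trace H (W, \<S>)"
    unfolding has_trace_def using f by (intro exI[of _ f] exI[of _ "(`) f"]) auto
qed

lemma incidence_mat_ones: "incidence_mat (ones_mat k 1) ({..<k}, {{..<k}})"
  unfolding incidence_mat_def
  by (intro exI[of _ id] exI[of _ "\<lambda>_. {..<k}"]) (auto simp: ones_mat_def bij_betw_def inj_on_def)

text \<open>Such a trace is an injection of \<open>k\<close> points into a single member of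
  \<open>\<S>\<close>; forbidding it bounds the size of every member.\<close>

lemma has_trace_full_edge_iff:
  assumes "finite W" "\<S> \<subseteq> Pow W"
  shows "has_trace ({..<k}, {{..<k}}) (W, \<S>) \<longleftrightarrow> (\<exists>S\<in>\<S>. k \<le> card S)"
proof
  assume "has_trace ({..<k}, {{..<k}}) (W, \<S>)"
  then obtain f :: "nat \<Rightarrow> 'a" and S where f: "inj_on f {..<k}" "f ` {..<k} \<subseteq> S" and S: "S \<in> \<S>"
    unfolding has_trace_def by auto
  then show "\<exists>S\<in>\<S>. k \<le> card S"
    using assms by (metis PowD card_inj_on_le card_lessThan finite_subset subsetD)
next
  assume "\<exists>S\<in>\<S>. k \<le> card S"
  then obtain S where S: "S \<in> \<S>" "k \<le> card S" by blast
  then have "finite S" "S \<subseteq> W"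
    using assms by (auto intro: finite_subset)
  then obtain f where f: "inj_on f {..<k}" "f ` {..<k} \<subseteq> S"
    using S(2) card_le_inj[of "{..<k}" S] by auto
  then show "has_trace ({..<k}, {{..<k}}) (W, \<S>)"
    unfolding has_trace_def using S(1) \<open>S \<subseteq> W\<close>
    by (intro exI[of _ f] exI[of _ "\<lambda>_. S"]) auto
qed

lemma card_subsets_card_less:
  assumes "finite W"
  shows "card {S. S \<subseteq> W \<and> card S < r} = (\<Sum>i<r. card W choose i)"
proof -
  have "{S. S \<subseteq> W \<and> card S < r} = (\<Union>i<r. {S. S \<subseteq> W \<and> card S = i})" by auto
  also have "card \<dots> = (\<Sum>i<r. card {S. S \<subseteq> W \<and> card S = i})"
    using assms by (intro card_UN_disjoint) auto
  also have "\<dots> = (\<Sum>i<r. card W choose i)"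
    using assms by (simp add: n_subsets)
  finally show ?thesis .
qed

lemma finite_uniform_cards: "finite {card E | E. uniform_hypergraph p ({..<m::nat}, E) \<and> P E}"
proof (rule finite_subset)
  show "{card E | E. uniform_hypergraph p ({..<m::nat}, E) \<and> P E} \<subseteq> card ` Pow (Pow {..<m})"
    by (auto simp: uniform_hypergraph_def)
qed simp

lemma ex_hyper_eq_Max_embeds:
  assumes "\<forall>e\<in>snd H. e \<subseteq> fst H"
  shows "ex_hyper p m H =
    Max {card E | E. uniform_hypergraph p ({..<m}, E) \<and> \<not> embeds H ({..<m}, E)}"
  unfolding ex_hyper_def copy_iff_embeds[OF assms] ..

lemma card_le_ex_hyper:
  assumes "\<forall>e\<in>snd H. e \<subseteq> fst H" "uniform_hypergraph p ({..<m}, E)" "\<not> embeds H ({..<m}, E)"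
  shows "card E \<le> ex_hyper p m H"
  unfolding ex_hyper_eq_Max_embeds[OF assms(1)]
  by (rule Max_ge[OF finite_uniform_cards]) (use assms in blast)

text \<open>Since \<open>H\<close> has an edge, the edgeless hypergraph contains no copy of it, so
  \<open>Max\<close> is taken over a nonempty set.\<close>

lemma ex_hyper_attained:
  assumes "\<forall>e\<in>snd H. e \<subseteq> fst H" "snd H \<noteq> {}"
  obtains E where "uniform_hypergraph p ({..<m}, E)" "\<not> embeds H ({..<m}, E)"
    "card E = ex_hyper p m H"
proof -
  let ?X = "{card E | E. uniform_hypergraph p ({..<m}, E) \<and> \<not> embeds H ({..<m}, E)}"
  have "uniform_hypergraph p ({..<m}, {}) \<and> \<not> embeds H ({..<m}, {})"
    using assms(2) by (auto simp: uniform_hypergraph_def embeds_def)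
  then have "?X \<noteq> {}" by blast
  then have "Max ?X \<in> ?X"
    by (intro Max_in finite_uniform_cards)
  then show thesis
    using that unfolding ex_hyper_eq_Max_embeds[OF assms(1)] by fastforce
qed

text \<open>A column with at most \<open>r\<close> ones that restricts to an \<open>r\<close>-element edge is that edge, so only the
  \<open>r\<close>-element sets of an extremal family are constrained by \<open>F\<close>.\<close>

lemma forb_ones_incidence_mat:
  assumes F: "incidence_mat F H" and H: "uniform_hypergraph r H" "snd H \<noteq> {}"
  shows "forb m {ones_mat (Suc r) 1, F} = (\<Sum>i<r. m choose i) + ex_hyper r m H"
proof -
  let ?W = "{..<m}"
  let ?P = "\<lambda>\<S>. \<S> \<subseteq> Pow ?W \<and> (\<forall>S\<in>\<S>. card S \<le> r) \<and> \<not> embeds H (?W, {S \<in> \<S>. card S = r})"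
  have edges: "\<forall>e\<in>snd H. e \<subseteq> fst H"
    using H(1) by (simp add: uniform_hypergraph_def)
  have "(\<S> \<subseteq> Pow ?W \<and> \<not> has_trace ({..<Suc r}, {{..<Suc r}}) (?W, \<S>) \<and> \<not> has_trace H (?W, \<S>))
      \<longleftrightarrow> ?P \<S>" for \<S>
  \<comment> \<open>\<open>has_trace_iff_embeds\<close> requires the size bound. Where the case
    condition fails, both sides are false.\<close>
  proof (cases "\<S> \<subseteq> Pow ?W \<and> (\<forall>S\<in>\<S>. card S \<le> r)")
    case True
    then show ?thesis
      using has_trace_full_edge_iff[of ?W \<S> "Suc r"] has_trace_iff_embeds[OF H(1), of ?W \<S>]
      by (auto simp: not_less_eq_eq)
  next
    case False
    then show ?thesis
      using has_trace_full_edge_iff[of ?W \<S> "Suc r"] by (auto simp: not_less_eq_eq)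
  qed
  then have "forb m {ones_mat (Suc r) 1, F} = Max {card \<S> | \<S>. ?P \<S>}"
    unfolding forb_eq_Max_traces[OF incidence_mat_ones F] by simp
  also have "\<dots> = (\<Sum>i<r. m choose i) + ex_hyper r m H"
  proof (rule Max_eqI)
    show "finite {card \<S> | \<S>. ?P \<S>}"
      by (rule finite_subset[of _ "card ` Pow (Pow ?W)"]) auto
  next
    fix n assume "n \<in> {card \<S> | \<S>. ?P \<S>}"
    then obtain \<S> where n: "n = card \<S>" and \<S>: "?P \<S>" by blast
    have fin: "finite \<S>"
      using \<S> by (meson finite_Pow_iff finite_lessThan finite_subset)
    \<comment> \<open>Upper bound, split by size: members smaller than \<open>r\<close> are among
      all smaller subsets, and those of size \<open>r\<close> form a uniform hypergraph without a
      copy of \<open>H\<close>.\<close>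
    have "\<S> = {S \<in> \<S>. card S < r} \<union> {S \<in> \<S>. card S = r}"
      using \<S> by force
    moreover have "card ({S \<in> \<S>. card S < r} \<union> {S \<in> \<S>. card S = r}) =
        card {S \<in> \<S>. card S < r} + card {S \<in> \<S>. card S = r}"
      using fin by (intro card_Un_disjoint) auto
    moreover have "card {S \<in> \<S>. card S < r} \<le> card {S. S \<subseteq> ?W \<and> card S < r}"
      using \<S> by (intro card_mono) auto
    moreover have "card {S \<in> \<S>. card S = r} \<le> ex_hyper r m H"
      using \<S> edges by (intro card_le_ex_hyper) (auto simp: uniform_hypergraph_def)
    ultimately show "n \<le> (\<Sum>i<r. m choose i) + ex_hyper r m H"
      using n by (simp add: card_subsets_card_less)
  next
    obtain E where E: "uniform_hypergraph r (?W, E)" "\<not> embeds H (?W, E)" "card E = ex_hyper r m H"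
      using ex_hyper_attained[OF edges H(2)] by blast
    have E': "E \<subseteq> Pow ?W" "\<And>S. S \<in> E \<Longrightarrow> card S = r"
      using E(1) by (auto simp: uniform_hypergraph_def)
    \<comment> \<open>The bound is attained by adding all sets of size below \<open>r\<close> to an
      extremal hypergraph \<open>E\<close>.\<close>
    define \<S> where "\<S> = {S. S \<subseteq> ?W \<and> card S < r} \<union> E"
    have "{S \<in> \<S>. card S = r} = E"
      using E' by (auto simp: \<S>_def)
    then have "?P \<S>"
      using E E' by (auto simp: \<S>_def)
    moreover have "card \<S> = (\<Sum>i<r. m choose i) + ex_hyper r m H"
      unfolding \<S>_def using E' E(3) finite_subset[OF E'(1)]
      by (subst card_Un_disjoint) (auto simp: card_subsets_card_less)
    ultimately show "(\<Sum>i<r. m choose i) + ex_hyper r m H \<in> {card \<S> | \<S>. ?P \<S>}"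
      by (intro CollectI exI[of _ \<S>]) simp
  qed
  finally show ?thesis .
qed

section \<open>Complete multipartite hypergraphs\<close>

lemma incidence_mat_one: "incidence_mat (1\<^sub>m n) ({..<n}, (\<lambda>i. {i}) ` {..<n})"
  unfolding incidence_mat_def
  by (intro exI[of _ id] exI[of _ "\<lambda>i. {i}"]) (auto simp: bij_betw_def inj_on_def)

lemma incidence_mat_row_col_perm:
  assumes "row_col_perm A B" "incidence_mat B G"
  shows "incidence_mat A G"
proof -
  obtain p q where p: "p permutes {..<dim_row B}" and q: "q permutes {..<dim_col B}"
    and A: "A = mat (dim_row B) (dim_col B) (\<lambda>(i, j). B $$ (p i, q j))"
    using assms(1) unfolding row_col_perm_def by blast
  obtain \<rho> \<gamma> where \<rho>: "bij_betw \<rho> {..<dim_row B} (fst G)" and \<gamma>: "bij_betw \<gamma> {..<dim_col B} (snd G)"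
    and B: "\<And>i j. i < dim_row B \<Longrightarrow> j < dim_col B \<Longrightarrow> B $$ (i, j) = of_bool (\<rho> i \<in> \<gamma> j)"
    using assms(2) unfolding incidence_mat_def by blast
  have "p i < dim_row B \<longleftrightarrow> i < dim_row B" "q i < dim_col B \<longleftrightarrow> i < dim_col B" for i
    using permutes_in_image[OF p] permutes_in_image[OF q] by auto
  then show ?thesis
    unfolding incidence_mat_def
    using bij_betw_trans[OF permutes_imp_bij[OF p] \<rho>] bij_betw_trans[OF permutes_imp_bij[OF q] \<gamma>] B
    by (intro exI[of _ "\<rho> \<circ> p"] exI[of _ "\<gamma> \<circ> q"]) (simp add: A)
qed

lemma incidence_mat_iso:
  assumes "incidence_mat A G" "\<And>e. e \<in> snd G \<Longrightarrow> e \<subseteq> fst G" "hypergraph_iso G H"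
  shows "incidence_mat A H"
proof -
  obtain \<rho> \<gamma> where \<rho>: "bij_betw \<rho> {..<dim_row A} (fst G)" and \<gamma>: "bij_betw \<gamma> {..<dim_col A} (snd G)"
    and A: "\<And>i j. i < dim_row A \<Longrightarrow> j < dim_col A \<Longrightarrow> A $$ (i, j) = of_bool (\<rho> i \<in> \<gamma> j)"
    using assms(1) unfolding incidence_mat_def by blast
  obtain f where f: "bij_betw f (fst G) (fst H)" "snd H = (`) f ` snd G"
    using assms(3) unfolding hypergraph_iso_def by blast
  have inj: "inj_on f (fst G)"
    using f(1) by (simp add: bij_betw_def)
  have "inj_on ((`) f) (snd G)"
    using inj assms(2) by (meson inj_onI inj_on_image_eq_iff)
  then have "bij_betw ((`) f) (snd G) (snd H)"
    using f(2) by (simp add: bij_betw_def)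
  moreover have "f (\<rho> i) \<in> f ` \<gamma> j \<longleftrightarrow> \<rho> i \<in> \<gamma> j" if "i < dim_row A" "j < dim_col A" for i j
  proof -
    have "\<rho> i \<in> fst G" "\<gamma> j \<in> snd G"
      using \<rho> \<gamma> that by (auto simp: bij_betw_def)
    then show ?thesis
      using inj_on_image_mem_iff[OF inj] assms(2) by blast
  qed
  ultimately show ?thesis
    unfolding incidence_mat_def
    using bij_betw_trans[OF \<rho> f(1)] bij_betw_trans[OF \<gamma>] A
    by (intro exI[of _ "f \<circ> \<rho>"] exI[of _ "(`) f \<circ> \<gamma>"]) simp
qed

text \<open>The counterpart of \<open>mat_product\<close> for set systems: stacking two columns
  forms the disjoint union of their supports.\<close>

definition hypergraph_join :: "'a hypergraph \<Rightarrow> 'b hypergraph \<Rightarrow> ('a + 'b) hypergraph" where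
  "hypergraph_join G H = (fst G <+> fst H, (\<lambda>(d, e). d <+> e) ` (snd G \<times> snd H))"

text \<open>A stacked column determines its two constituents; this gives injectivity of the column
  labelling of a product.\<close>

lemma Plus_eqD:
  assumes "A <+> B = C <+> D"
  shows "A = C" "B = D"
proof -
  have "Inl -` (S <+> Y) = S" "Inr -` (S <+> Y) = Y" for S :: "'a set" and Y :: "'b set"
    by auto
  then show "A = C" "B = D"
    using assms by metis+
qed

lemma incidence_mat_product:
  assumes "incidence_mat A G" "incidence_mat B H"
  shows "incidence_mat (mat_product A B) (hypergraph_join G H)"
proof -
  obtain \<rho> \<gamma> where \<rho>: "bij_betw \<rho> {..<dim_row A} (fst G)" and \<gamma>: "bij_betw \<gamma> {..<dim_col A} (snd G)"
    and A: "\<And>i j. i < dim_row A \<Longrightarrow> j < dim_col A \<Longrightarrow> A $$ (i, j) = of_bool (\<rho> i \<in> \<gamma> j)"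
    using assms(1) unfolding incidence_mat_def by blast
  obtain \<rho>' \<gamma>' where \<rho>': "bij_betw \<rho>' {..<dim_row B} (fst H)" and \<gamma>': "bij_betw \<gamma>' {..<dim_col B} (snd H)"
    and B: "\<And>i j. i < dim_row B \<Longrightarrow> j < dim_col B \<Longrightarrow> B $$ (i, j) = of_bool (\<rho>' i \<in> \<gamma>' j)"
    using assms(2) unfolding incidence_mat_def by blast
  \<comment> \<open>The labels follow the layout of \<open>mat_product\<close>: the rows of
    \<open>A\<close> come first, and quotient and remainder of \<open>j\<close> by
    \<open>dim_col B\<close> name the two stacked columns.\<close>
  define \<sigma> where "\<sigma> i = (if i < dim_row A then Inl (\<rho> i) else Inr (\<rho>' (i - dim_row A)))" for i
  define \<delta> where "\<delta> j = \<gamma> (j div dim_col B) <+> \<gamma>' (j mod dim_col B)" for j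
  have "bij_betw \<sigma> {..<dim_row A + dim_row B} (fst G <+> fst H)"
  proof (rule bij_betw_imageI)
    show "inj_on \<sigma> {..<dim_row A + dim_row B}"
    proof (rule inj_onI)
      fix i j assume *: "i \<in> {..<dim_row A + dim_row B}" "j \<in> {..<dim_row A + dim_row B}" "\<sigma> i = \<sigma> j"
      then have "i - dim_row A < dim_row B" if "\<not> i < dim_row A" using that by auto
      moreover have "j - dim_row A < dim_row B" if "\<not> j < dim_row A" using that * by auto
      ultimately show "i = j"
        using * \<rho> \<rho>' by (auto simp: \<sigma>_def bij_betw_def inj_on_eq_iff split: if_splits)
    qed
    show "\<sigma> ` {..<dim_row A + dim_row B} = fst G <+> fst H"
    proof
      show "\<sigma> ` {..<dim_row A + dim_row B} \<subseteq> fst G <+> fst H"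
        using \<rho> \<rho>' by (auto simp: \<sigma>_def bij_betw_def)
      have "Inl (\<rho> i) \<in> \<sigma> ` {..<dim_row A + dim_row B}" if "i < dim_row A" for i
        using that by (intro image_eqI[of _ _ i]) (auto simp: \<sigma>_def)
      moreover have "Inr (\<rho>' i) \<in> \<sigma> ` {..<dim_row A + dim_row B}" if "i < dim_row B" for i
        using that by (intro image_eqI[of _ _ "dim_row A + i"]) (auto simp: \<sigma>_def)
      ultimately show "fst G <+> fst H \<subseteq> \<sigma> ` {..<dim_row A + dim_row B}"
        by (auto simp flip: bij_betw_imp_surj_on[OF \<rho>] bij_betw_imp_surj_on[OF \<rho>'])
    qed
  qed
  moreover have divmod: "j div dim_col B < dim_col A" "j mod dim_col B < dim_col B"
    if "j < dim_col A * dim_col B" for j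
    using that by (cases "dim_col B"; simp add: less_mult_imp_div_less)+
  have "bij_betw \<delta> {..<dim_col A * dim_col B} ((\<lambda>(d, e). d <+> e) ` (snd G \<times> snd H))"
  proof (rule bij_betw_imageI)
    show "inj_on \<delta> {..<dim_col A * dim_col B}"
    proof (rule inj_onI)
      fix i j assume ij: "i \<in> {..<dim_col A * dim_col B}" "j \<in> {..<dim_col A * dim_col B}" and "\<delta> i = \<delta> j"
      then have "\<gamma> (i div dim_col B) = \<gamma> (j div dim_col B)" "\<gamma>' (i mod dim_col B) = \<gamma>' (j mod dim_col B)"
        unfolding \<delta>_def by (blast dest: Plus_eqD)+
      then have "i div dim_col B = j div dim_col B" "i mod dim_col B = j mod dim_col B"
        using divmod ij \<gamma> \<gamma>' by (auto simp: bij_betw_def inj_on_eq_iff)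
      then show "i = j" by (metis div_mult_mod_eq)
    qed
    show "\<delta> ` {..<dim_col A * dim_col B} = (\<lambda>(d, e). d <+> e) ` (snd G \<times> snd H)"
    proof
      show "\<delta> ` {..<dim_col A * dim_col B} \<subseteq> (\<lambda>(d, e). d <+> e) ` (snd G \<times> snd H)"
        using divmod bij_betwE[OF \<gamma>] bij_betwE[OF \<gamma>'] by (fastforce simp: \<delta>_def)
      \<comment> \<open>Quotient and remainder recover \<open>i\<close> and \<open>j\<close> from
        \<open>i * dim_col B + j\<close>, so every pair of edges occurs.\<close>
      have "\<gamma> i <+> \<gamma>' j \<in> \<delta> ` {..<dim_col A * dim_col B}" if "i < dim_col A" "j < dim_col B" for i j
      proof (rule image_eqI)
        have "i * dim_col B + j < (i + 1) * dim_col B"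
          using that by simp
        also have "\<dots> \<le> dim_col A * dim_col B"
          using that by (intro mult_right_mono) auto
        finally show "i * dim_col B + j \<in> {..<dim_col A * dim_col B}" by simp
        show "\<gamma> i <+> \<gamma>' j = \<delta> (i * dim_col B + j)"
          using that by (simp add: \<delta>_def)
      qed
      then show "(\<lambda>(d, e). d <+> e) ` (snd G \<times> snd H) \<subseteq> \<delta> ` {..<dim_col A * dim_col B}"
        by (auto simp flip: bij_betw_imp_surj_on[OF \<gamma>] bij_betw_imp_surj_on[OF \<gamma>'])
    qed
  qed
  moreover have "mat_product A B $$ (i, j) = of_bool (\<sigma> i \<in> \<delta> j)"
    if "i < dim_row A + dim_row B" "j < dim_col A * dim_col B" for i j
    using that divmod A B by (simp add: mat_product_def \<sigma>_def \<delta>_def) auto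
  ultimately show ?thesis
    unfolding incidence_mat_def hypergraph_join_def
    by (intro exI[of _ \<sigma>] exI[of _ \<delta>]) (simp add: mat_product_def)
qed

lemma fst_complete_multipartite:
  "fst (complete_multipartite s) = (SIGMA i:{..<length s}. {..<s ! i})"
  by (simp add: complete_multipartite_def Let_def)

text \<open>A vertex carries its part as first component, so a vertex of \<open>e\<close> in part
  \<open>i\<close> amounts to a \<open>j\<close> with \<open>(i, j) \<in> e\<close>.\<close>

lemma mem_snd_complete_multipartite:
  "e \<in> snd (complete_multipartite s) \<longleftrightarrow>
     e \<subseteq> fst (complete_multipartite s) \<and> (\<forall>i<length s. \<exists>!j. (i, j) \<in> e)"
proof -
  let ?V = "SIGMA i:{..<length s}. {..<s ! i}"
  have "(\<exists>!v. v \<in> e \<and> v \<in> {i} \<times> {..<s ! i}) \<longleftrightarrow> (\<exists>!j. (i, j) \<in> e)" if "e \<subseteq> ?V" for i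
  proof -
    have "v \<in> e \<and> v \<in> {i} \<times> {..<s ! i} \<longleftrightarrow> v \<in> e \<and> fst v = i" for v
      using that by auto
    then show ?thesis
      by (simp only:) (auto simp: Ex1_def)
  qed
  then show ?thesis
    unfolding fst_complete_multipartite by (simp add: complete_multipartite_def Let_def cong: conj_cong)
qed

text \<open>The induction step for products of identity matrices: the new factor becomes part
  \<open>0\<close> and the old parts move up by one.\<close>

lemma complete_multipartite_Cons_iso:
  "hypergraph_iso (hypergraph_join ({..<x}, (\<lambda>i. {i}) ` {..<x}) (complete_multipartite s))
     (complete_multipartite (x # s))"
proof -
  let ?K = "complete_multipartite s" and ?L = "complete_multipartite (x # s)"
  define f :: "nat + nat \<times> nat \<Rightarrow> nat \<times> nat" where
    "f v = (case v of Inl j \<Rightarrow> (0, j) | Inr (i, j) \<Rightarrow> (Suc i, j))" for v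
  have f_simps [simp]: "f (Inl j) = (0, j)" "f (Inr (i, j)) = (Suc i, j)" for i j
    by (simp_all add: f_def)
  have inj: "inj f"
    by (auto simp: inj_def f_def split: sum.splits)
  have V: "f ` ({..<x} <+> fst ?K) = fst ?L"
  proof
    show "f ` ({..<x} <+> fst ?K) \<subseteq> fst ?L"
      by (auto simp: fst_complete_multipartite)
    show "fst ?L \<subseteq> f ` ({..<x} <+> fst ?K)"
    proof
      fix v assume "v \<in> fst ?L"
      then obtain i j where v: "v = (i, j)" "i < Suc (length s)" "j < (x # s) ! i"
        by (auto simp: fst_complete_multipartite)
      show "v \<in> f ` ({..<x} <+> fst ?K)"
      proof (cases i)
        case 0
        then show ?thesis using v by (intro image_eqI[of _ _ "Inl j"]) auto
      next
        case (Suc i')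
        then show ?thesis using v
          by (intro image_eqI[of _ _ "Inr (i', j)"]) (auto simp: fst_complete_multipartite)
      qed
    qed
  qed
  have "snd ?L = (`) f ` (\<lambda>(d, e). d <+> e) ` ((\<lambda>i. {i}) ` {..<x} \<times> snd ?K)"
  proof (intro equalityI subsetI)
    fix e assume e: "e \<in> snd ?L"
    \<comment> \<open>The vertices of \<open>e\<close> outside part \<open>0\<close>, with part
      indices moved back down; this is the edge of the smaller hypergraph.\<close>
    define e' where "e' = {(i, j). (Suc i, j) \<in> e}"
    obtain j where j: "(0, j) \<in> e" "\<And>j'. (0, j') \<in> e \<Longrightarrow> j' = j"
      using e unfolding mem_snd_complete_multipartite by fastforce
    have sub: "e \<subseteq> fst ?L"
      using e unfolding mem_snd_complete_multipartite by blast
    then have "(0, j) \<in> fst ?L"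
      using j(1) by blast
    then have "j < x"
      by (simp add: fst_complete_multipartite)
    have "e' \<subseteq> fst ?K"
      using sub by (auto simp: fst_complete_multipartite e'_def)
    moreover have "\<exists>!k. (i, k) \<in> e'" if "i < length s" for i
      using e that unfolding mem_snd_complete_multipartite e'_def by simp
    ultimately have "e' \<in> snd ?K"
      unfolding mem_snd_complete_multipartite by blast
    moreover have "e = f ` ({j} <+> e')"
    proof (intro equalityI subsetI)
      fix v assume "v \<in> e"
      then show "v \<in> f ` ({j} <+> e')"
      proof (cases v)
        case (Pair i k)
        then show ?thesis
        proof (cases i)
          case 0
          then show ?thesis using Pair \<open>v \<in> e\<close> j(2) by (intro image_eqI[of _ _ "Inl j"]) auto
        next
          case (Suc i')
          then show ?thesis using Pair \<open>v \<in> e\<close> by (intro image_eqI[of _ _ "Inr (i', k)"]) (auto simp: e'_def)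
        qed
      qed
    qed (use j(1) in \<open>auto simp: e'_def\<close>)
    ultimately show "e \<in> (`) f ` (\<lambda>(d, e). d <+> e) ` ((\<lambda>i. {i}) ` {..<x} \<times> snd ?K)"
      using \<open>j < x\<close> by auto
  next
    fix e assume "e \<in> (`) f ` (\<lambda>(d, e). d <+> e) ` ((\<lambda>i. {i}) ` {..<x} \<times> snd ?K)"
    then obtain j e' where j: "j < x" and e': "e' \<in> snd ?K" and e: "e = f ` ({j} <+> e')"
      by auto
    have mem: "(i, k) \<in> e \<longleftrightarrow> (case i of 0 \<Rightarrow> k = j | Suc i' \<Rightarrow> (i', k) \<in> e')" for i k
      unfolding e by (force split: nat.splits)
    have "\<exists>!k. (i, k) \<in> e" if "i < Suc (length s)" for i
      using that e' unfolding mem mem_snd_complete_multipartite by (cases i) auto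
    moreover have "{j} <+> e' \<subseteq> {..<x} <+> fst ?K"
      using e' j unfolding mem_snd_complete_multipartite by blast
    then have "e \<subseteq> fst ?L"
      unfolding e V[symmetric] by (rule image_mono)
    ultimately show "e \<in> snd ?L"
      unfolding mem_snd_complete_multipartite by simp
  qed
  moreover have "bij_betw f ({..<x} <+> fst ?K) (fst ?L)"
    using V inj by (metis bij_betw_imageI inj_on_subset subset_UNIV)
  ultimately show ?thesis
    unfolding hypergraph_iso_def hypergraph_join_def by auto
qed

lemma incidence_mat_complete_multipartite:
  "incidence_mat (mat_product_list (map (\<lambda>x. 1\<^sub>m x) s)) (complete_multipartite s)"
proof (induction s)
  case Nil
  \<comment> \<open>The empty product has no rows and one column, matching no vertices and the
    single edge \<open>{}\<close>. With no rows to label, any row labelling will do.\<close>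
  have "complete_multipartite [] = ({}, {{}})"
    by (auto simp: complete_multipartite_def)
  then show ?case
    unfolding incidence_mat_def mat_product_list_def
    by (intro exI[of _ undefined] exI[of _ "\<lambda>_. {}"]) (auto simp: bij_betw_def inj_on_def)
next
  case (Cons x s)
  have "incidence_mat (mat_product (1\<^sub>m x) (mat_product_list (map (\<lambda>x. 1\<^sub>m x) s)))
      (hypergraph_join ({..<x}, (\<lambda>i. {i}) ` {..<x}) (complete_multipartite s))"
    by (rule incidence_mat_product[OF incidence_mat_one Cons.IH])
  then have "incidence_mat (mat_product (1\<^sub>m x) (mat_product_list (map (\<lambda>x. 1\<^sub>m x) s)))
      (complete_multipartite (x # s))"
  proof (rule incidence_mat_iso[OF _ _ complete_multipartite_Cons_iso])
    fix e assume "e \<in> snd (hypergraph_join ({..<x}, (\<lambda>i. {i}) ` {..<x}) (complete_multipartite s))"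
    then show "e \<subseteq> fst (hypergraph_join ({..<x}, (\<lambda>i. {i}) ` {..<x}) (complete_multipartite s))"
      by (auto simp: hypergraph_join_def mem_snd_complete_multipartite)
  qed
  then show ?case
    by (simp add: mat_product_list_def)
qed

text \<open>An edge meets each part exactly once, so projecting its vertices to their part indices
  is a bijection.\<close>

lemma uniform_complete_multipartite:
  "uniform_hypergraph (length s) (complete_multipartite s)"
  unfolding uniform_hypergraph_def
proof (intro conjI ballI)
  show "finite (fst (complete_multipartite s))"
    by (simp add: fst_complete_multipartite)
  fix e assume e: "e \<in> snd (complete_multipartite s)"
  show sub: "e \<subseteq> fst (complete_multipartite s)"
    using e by (simp add: mem_snd_complete_multipartite)
  have ex1: "\<exists>!j. (i, j) \<in> e" if "i < length s" for i
    using e that by (simp add: mem_snd_complete_multipartite)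
  have "bij_betw fst e {..<length s}"
  proof (rule bij_betw_imageI)
    show "inj_on fst e"
      using ex1 sub by (fastforce simp: inj_on_def fst_complete_multipartite)
    show "fst ` e = {..<length s}"
      using ex1 sub by (force simp: fst_complete_multipartite)
  qed
  then show "card e = length s"
    by (simp add: bij_betw_same_card)
qed

text \<open>Every part is nonempty and so contains the vertex with second component
  \<open>0\<close>; these vertices together form an edge.\<close>

lemma complete_multipartite_has_edge:
  assumes "\<forall>x\<in>set s. x > 0"
  shows "snd (complete_multipartite s) \<noteq> {}"
proof -
  have "{..<length s} \<times> {0} \<in> snd (complete_multipartite s)"
    using assms by (auto simp: fst_complete_multipartite mem_snd_complete_multipartite)
  then show ?thesis by blast
qed

lemma forb_complete_multipartite:
  assumes "\<forall>x\<in>set s. x > 0"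
  shows "forb m {ones_mat (Suc (length s)) 1, mat_product_list (map (\<lambda>x. 1\<^sub>m x) s)} =
    (\<Sum>i<length s. m choose i) + ex_hyper (length s) m (complete_multipartite s)"
  by (rule forb_ones_incidence_mat[OF incidence_mat_complete_multipartite
        uniform_complete_multipartite complete_multipartite_has_edge[OF assms]])

section \<open>Complete bipartite graphs and \<open>F11\<close>\<close>

lemma hypergraph_join_complete_bipartite:
  "hypergraph_join ({..<a}, (\<lambda>i. {i}) ` {..<a}) ({..<b}, (\<lambda>i. {i}) ` {..<b}) = complete_bipartite a b"
proof -
  have "{i} <+> {j} = {Inl i, Inr j}" for i j :: nat by auto
  then show ?thesis
    by (auto simp: hypergraph_join_def complete_bipartite_def image_iff)
qed

lemma incidence_mat_F11: "incidence_mat F11 (complete_bipartite 2 2)"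
  using incidence_mat_row_col_perm[OF F11_eq_product
      incidence_mat_product[OF incidence_mat_one incidence_mat_one]]
  unfolding hypergraph_join_complete_bipartite .

lemma uniform_complete_bipartite: "uniform_hypergraph 2 (complete_bipartite a b)"
  by (auto simp: uniform_hypergraph_def complete_bipartite_def)

lemma edges_complete_bipartite: "\<forall>e\<in>snd (complete_bipartite a b). e \<subseteq> fst (complete_bipartite a b)"
  by (auto simp: complete_bipartite_def)

text \<open>No vertex is isolated, which allows graphs on fewer than \<open>m\<close> vertices to
  give lower bounds for \<open>ex_graph m\<close>.\<close>

lemma vertices_complete_bipartite:
  assumes "a > 0" "b > 0"
  shows "fst (complete_bipartite a b) \<subseteq> \<Union> (snd (complete_bipartite a b))"
proof
  fix v assume v: "v \<in> fst (complete_bipartite a b)"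
  show "v \<in> \<Union> (snd (complete_bipartite a b))"
  proof (cases v)
    case (Inl i)
    then have "{v, Inr 0} \<in> snd (complete_bipartite a b)"
      using v assms by (auto simp: complete_bipartite_def)
    then show ?thesis by blast
  next
    case (Inr j)
    then have "{Inl 0, v} \<in> snd (complete_bipartite a b)"
      using v assms by (auto simp: complete_bipartite_def)
    then show ?thesis by blast
  qed
qed

lemma complete_bipartite_has_edge:
  assumes "a > 0" "b > 0"
  shows "snd (complete_bipartite a b) \<noteq> {}"
proof -
  have "{Inl 0, Inr 0} \<in> snd (complete_bipartite a b)"
    using assms by (auto simp: complete_bipartite_def)
  then show ?thesis by blast
qed

text \<open>The case \<open>r = 2\<close>, where the binomial sum is
  \<open>(m choose 0) + (m choose 1) = 1 + m\<close>.\<close>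

lemma forb_F11: "forb m {ones_mat 3 1, F11} = 1 + m + ex_graph m (complete_bipartite 2 2)"
  using forb_ones_incidence_mat[OF incidence_mat_F11 uniform_complete_bipartite
      complete_bipartite_has_edge, of m]
  by (simp add: ex_graph_def eval_nat_numeral)

section \<open>The growth of the extremal number of the four-cycle\<close>

text \<open>Without isolated vertices in \<open>H\<close>, adding isolated vertices to \<open>G\<close> creates no copy of \<open>H\<close>.\<close>

lemma card_le_ex_hyper_of_card_le:
  fixes G :: "'b hypergraph"
  assumes H: "\<forall>e\<in>snd H. e \<subseteq> fst H" "fst H \<subseteq> \<Union> (snd H)"
    and G: "uniform_hypergraph p G" "\<not> embeds H G" "card (fst G) \<le> m"
  shows "card (snd G) \<le> ex_hyper p m H"
proof -
  have fin: "finite (fst G)" and edges: "\<And>e. e \<in> snd G \<Longrightarrow> e \<subseteq> fst G \<and> card e = p"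
    using G(1) by (auto simp: uniform_hypergraph_def)
  obtain h where h: "inj_on h (fst G)" "h ` fst G \<subseteq> {..<m}"
    using card_le_inj[OF fin, of "{..<m}"] G(3) by auto
  have inj: "inj_on ((`) h) (snd G)"
    using h(1) edges by (meson inj_onI inj_on_image_eq_iff)
  have card: "card (h ` e) = p" if "e \<in> snd G" for e
    using edges[OF that] h(1) by (metis card_image inj_on_subset)
  have "uniform_hypergraph p ({..<m}, (`) h ` snd G)"
    using h(2) edges card by (fastforce simp: uniform_hypergraph_def)
  moreover have "\<not> embeds H ({..<m}, (`) h ` snd G)"
  proof
    assume "embeds H ({..<m}, (`) h ` snd G)"
    then obtain f where f: "inj_on f (fst H)" "(`) f ` snd H \<subseteq> (`) h ` snd G"
      unfolding embeds_def fst_conv snd_conv by (elim exE conjE) (rule that)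
    \<comment> \<open>\<open>k\<close> undoes the relabelling \<open>h\<close>, so that a copy among
      the relabelled edges is pulled back to a copy in \<open>G\<close>.\<close>
    define k where "k = inv_into (fst G) h"
    have kh: "k ` h ` e = e" if "e \<subseteq> fst G" for e
      using inv_into_image_cancel[OF h(1) that] by (simp add: k_def)
    have kf: "(k \<circ> f) ` e \<in> snd G \<and> f ` e \<subseteq> h ` fst G" if e: "e \<in> snd H" for e
    proof -
      have "f ` e \<in> (`) h ` snd G"
        by (rule subsetD[OF f(2) imageI[OF e]])
      then obtain d where d: "d \<in> snd G" "f ` e = h ` d"
        by (rule imageE) (rule that)
      have "(k \<circ> f) ` e = k ` f ` e"
        by (rule image_comp[symmetric])
      also have "\<dots> = d"
        using d kh edges by simp
      finally have "(k \<circ> f) ` e = d" .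
      then show ?thesis
        using d edges by (metis image_mono)
    qed
    \<comment> \<open>Every vertex of \<open>H\<close> lies in an edge, so the copy avoids the added
      vertices and stays where \<open>k\<close> is injective.\<close>
    then have "f ` fst H \<subseteq> h ` fst G"
      using H(2) by blast
    moreover have k: "bij_betw k (h ` fst G) (fst G)"
      unfolding k_def by (intro bij_betw_inv_into inj_on_imp_bij_betw h(1))
    ultimately have "inj_on (k \<circ> f) (fst H)" "(k \<circ> f) ` fst H \<subseteq> fst G"
      using f(1) by (meson bij_betw_imp_inj_on comp_inj_on inj_on_subset)
        (metis \<open>f ` fst H \<subseteq> h ` fst G\<close> k bij_betw_imp_surj_on image_comp image_mono)
    then have "embeds H G"
      unfolding embeds_def using kf by blast
    then show False using G(2) by blast
  qed
  ultimately have "card ((`) h ` snd G) \<le> ex_hyper p m H"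
    by (rule card_le_ex_hyper[OF H(1)])
  then show ?thesis
    by (simp add: card_image[OF inj])
qed

section \<open>Upper bound for graphs without a four-cycle\<close>

text \<open>Distinctness is stated only within each side; vertices on opposite sides differ because
  they form an edge with two elements.\<close>

lemma embeds_K22_iff:
  assumes "uniform_hypergraph 2 G"
  shows "embeds (complete_bipartite 2 2) G \<longleftrightarrow>
    (\<exists>u v x y. u \<noteq> v \<and> x \<noteq> y \<and> {{u, x}, {u, y}, {v, x}, {v, y}} \<subseteq> snd G)"
proof
  have K: "fst (complete_bipartite 2 2) = {Inl 0, Inl 1, Inr 0, Inr 1}"
    "snd (complete_bipartite 2 2) =
      {{Inl 0, Inr 0}, {Inl 0, Inr 1}, {Inl 1, Inr 0}, {Inl 1, Inr 1}}"
    by (auto simp: complete_bipartite_def less_2_cases_iff)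
  {
    assume "embeds (complete_bipartite 2 2) G"
    then obtain f where f: "inj_on f (fst (complete_bipartite 2 2))"
      "(`) f ` snd (complete_bipartite 2 2) \<subseteq> snd G"
      unfolding embeds_def by blast
    then show "\<exists>u v x y. u \<noteq> v \<and> x \<noteq> y \<and> {{u, x}, {u, y}, {v, x}, {v, y}} \<subseteq> snd G"
      unfolding K
      by (intro exI[of _ "f (Inl 0)"] exI[of _ "f (Inl 1)"] exI[of _ "f (Inr 0)"] exI[of _ "f (Inr 1)"])
        (simp add: inj_on_eq_iff)
  next
    assume "\<exists>u v x y. u \<noteq> v \<and> x \<noteq> y \<and> {{u, x}, {u, y}, {v, x}, {v, y}} \<subseteq> snd G"
    then obtain u v x y where uv: "u \<noteq> v" "x \<noteq> y"
      and E: "{u, x} \<in> snd G" "{u, y} \<in> snd G" "{v, x} \<in> snd G" "{v, y} \<in> snd G"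
      by auto
    have edge: "a \<noteq> b \<and> a \<in> fst G \<and> b \<in> fst G" if "{a, b} \<in> snd G" for a b
      using assms that by (force simp: uniform_hypergraph_def)
    define f where "f = case_sum (\<lambda>i::nat. if i = 0 then u else v) (\<lambda>i::nat. if i = 0 then x else y)"
    have "inj_on f (fst (complete_bipartite 2 2))"
      unfolding K f_def using uv edge[OF E(1)] edge[OF E(2)] edge[OF E(3)] edge[OF E(4)]
      by (auto simp: inj_on_def)
    moreover have "f ` fst (complete_bipartite 2 2) \<subseteq> fst G"
      unfolding K f_def using edge[OF E(1)] edge[OF E(4)] by auto
    moreover have "(`) f ` snd (complete_bipartite 2 2) \<subseteq> snd G"
      unfolding K f_def using E by auto
    ultimately show "embeds (complete_bipartite 2 2) G"
      unfolding embeds_def by blast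
  }
qed

text \<open>Double counting of the triples \<open>(v, a, b)\<close> with \<open>a\<close> and \<open>b\<close> adjacent to \<open>v\<close>: distinct
  \<open>a\<close>, \<open>b\<close> have at most one common neighbour.\<close>

lemma K22_free_card_bound:
  assumes G: "uniform_hypergraph 2 (V, E)" "\<not> embeds (complete_bipartite 2 2) (V, E)"
  shows "card E ^ 2 \<le> 3 * card V ^ 3"
proof -
  have fin: "finite V" and edge: "\<And>a b. {a, b} \<in> E \<Longrightarrow> a \<in> V \<and> b \<in> V"
    using G(1) by (auto simp: uniform_hypergraph_def)
  have unique: "v = w" if "a \<noteq> b" "{v, a} \<in> E" "{v, b} \<in> E" "{w, a} \<in> E" "{w, b} \<in> E" for a b v w
    using G(2) that unfolding embeds_K22_iff[OF G(1)] by (simp, metis)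
  define N where "N v = {a \<in> V. {v, a} \<in> E}" for v
  have finN: "finite (N v)" for v
    using fin by (simp add: N_def)
  \<comment> \<open>The degree sum. Every edge comes from a pair \<open>(v, a)\<close> with
    \<open>a \<in> N v\<close>, whence \<open>card E \<le> D\<close>.\<close>
  define D where "D = (\<Sum>v\<in>V. card (N v))"
  have "card E \<le> D"
  proof -
    have "E \<subseteq> (\<lambda>(v, a). {v, a}) ` (SIGMA v:V. N v)"
    proof
      fix e assume e: "e \<in> E"
      then have "card e = 2" using G(1) by (auto simp: uniform_hypergraph_def)
      then obtain a b where "e = {a, b}" by (auto simp: card_2_iff)
      then show "e \<in> (\<lambda>(v, a). {v, a}) ` (SIGMA v:V. N v)"
        using e edge by (intro image_eqI[of _ _ "(a, b)"]) (auto simp: N_def)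
    qed
    then have "card E \<le> card (SIGMA v:V. N v)"
      using fin finN by (meson card_image_le card_mono finite_SigmaI finite_imageI le_trans)
    also have "\<dots> = D"
      using fin finN by (simp add: D_def)
    finally show ?thesis .
  qed
  have squares: "(\<Sum>v\<in>V. card (N v) ^ 2) \<le> card V ^ 2 + D"
  proof -
    let ?T = "SIGMA v:V. N v \<times> N v"
    have finT: "finite ?T" using fin finN by auto
    have "(\<Sum>v\<in>V. card (N v) ^ 2) = card ?T"
      using fin finN by (simp add: card_cartesian_product power2_eq_square)
    \<comment> \<open>Triples with \<open>a \<noteq> b\<close> are determined by
      \<open>(a, b)\<close>, the common neighbour being unique; triples with \<open>a = b\<close>
      number at most \<open>D\<close>.\<close>
    also have "?T = {t \<in> ?T. fst (snd t) \<noteq> snd (snd t)} \<union> {t \<in> ?T. fst (snd t) = snd (snd t)}"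
      by blast
    also have "card \<dots> \<le> card {t \<in> ?T. fst (snd t) \<noteq> snd (snd t)} + card {t \<in> ?T. fst (snd t) = snd (snd t)}"
      by (rule card_Un_le)
    also have "card {t \<in> ?T. fst (snd t) \<noteq> snd (snd t)} \<le> card (V \<times> V)"
    proof (rule card_inj_on_le)
      show "inj_on snd {t \<in> ?T. fst (snd t) \<noteq> snd (snd t)}"
        using unique by (fastforce simp: inj_on_def N_def)
      show "snd ` {t \<in> ?T. fst (snd t) \<noteq> snd (snd t)} \<subseteq> V \<times> V"
        by (auto simp: N_def)
    qed (use fin in simp)
    also have "card {t \<in> ?T. fst (snd t) = snd (snd t)} \<le> card (SIGMA v:V. N v)"
    proof (rule card_inj_on_le)
      show "inj_on (\<lambda>(v, a, b). (v, a)) {t \<in> ?T. fst (snd t) = snd (snd t)}"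
        by (auto simp: inj_on_def)
      show "(\<lambda>(v, a, b). (v, a)) ` {t \<in> ?T. fst (snd t) = snd (snd t)} \<subseteq> (SIGMA v:V. N v)"
        by auto
    qed (use fin finN in auto)
    finally show ?thesis
      using fin finN by (simp add: D_def power2_eq_square)
  qed
  \<comment> \<open>Cauchy-Schwarz for the degrees against the constant \<open>1\<close>.\<close>
  have "real (D\<^sup>2) \<le> real ((\<Sum>v\<in>V. card (N v) ^ 2) * card V)"
    using sum_squared_le_sum_of_squares[of "\<lambda>v. real (card (N v))" V] by (simp add: D_def)
  then have "D\<^sup>2 \<le> (\<Sum>v\<in>V. card (N v) ^ 2) * card V"
    by (simp only: of_nat_le_iff)
  also have "\<dots> \<le> (card V ^ 2 + D) * card V"
    using squares by (rule mult_le_mono1)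
  finally have CS: "D\<^sup>2 \<le> (card V ^ 2 + D) * card V" .
  \<comment> \<open>With \<open>n = card V\<close>, \<open>CS\<close> reads
    \<open>D ^ 2 \<le> n ^ 3 + n * D\<close>. Bounding \<open>n * D\<close> by half of
    \<open>n ^ 2 + D ^ 2\<close> gives
    \<open>D ^ 2 \<le> 2 * n ^ 3 + n ^ 2 \<le> 3 * n ^ 3\<close>.\<close>
  have "2 * (card V * D) \<le> card V ^ 2 + D ^ 2"
    using sum_squares_bound[of "real (card V)" "real D"]
    by (metis (mono_tags, opaque_lifting) mult.assoc of_nat_add of_nat_le_iff of_nat_mult of_nat_numeral of_nat_power)
  moreover have "card V ^ 2 \<le> card V ^ 3"
    by (cases "card V = 0") (auto intro: power_increasing)
  moreover have "D\<^sup>2 \<le> card V ^ 3 + card V * D"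
    using CS by (simp add: algebra_simps power3_eq_cube power2_eq_square)
  ultimately have "D ^ 2 \<le> 3 * card V ^ 3" by linarith
  moreover have "card E ^ 2 \<le> D ^ 2"
    using \<open>card E \<le> D\<close> by (rule power_mono) simp
  ultimately show ?thesis by linarith
qed

section \<open>The affine plane over the field with \<open>2 ^ n\<close> elements\<close>

text \<open>The fixed points are the roots of \<open>x ^ q - x\<close>, which splits into
  \<open>q\<close> linear factors. Its derivative is the constant \<open>-1\<close>, as the
  characteristic divides \<open>q\<close>, so no root is repeated.\<close>

lemma card_frobenius_fixed_points:
  fixes q n :: nat
  assumes "Factorial_Ring.prime CHAR('a::alg_closed_field)" "n > 0" and q: "q = CHAR('a) ^ n"
  shows "card {x::'a. x ^ q = x} = q"
proof -
  have "q > 1"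
    unfolding q using assms(1,2) by (intro one_less_power prime_gt_1_nat)
  define p :: "'a poly" where "p = monom 1 q - monom 1 1"
  have deg: "degree p = q"
    using \<open>q > 1\<close> unfolding p_def diff_conv_add_uminus
    by (subst degree_add_eq_left) (simp_all add: degree_monom_eq)
  have "lead_coeff p = 1"
    using \<open>q > 1\<close> by (simp add: deg) (simp add: p_def)
  then obtain A where A: "size A = q" "p = (\<Prod>x\<in>#A. [:-x, 1:])"
    using alg_closed_imp_factorization[of p] deg by fastforce
  have "(of_nat q :: 'a) = 0"
    using \<open>n > 0\<close> by (simp add: q)
  then have deriv: "pderiv p = -1"
    by (simp add: p_def pderiv_diff pderiv_monom)
  \<comment> \<open>A repeated linear factor would make the derivative vanish at
    \<open>x\<close>.\<close>
  have count: "count A x \<le> 1" for x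
  proof (rule ccontr)
    assume "\<not> count A x \<le> 1"
    then have "replicate_mset 2 x \<subseteq># A"
      by (simp flip: count_le_replicate_mset_subset_eq)
    then obtain B where "A = {#x, x#} + B"
      by (auto simp: mset_subset_eq_exists_conv numeral_2_eq_2)
    then have "p = [:-x, 1:] * ([:-x, 1:] * (\<Prod>x\<in>#B. [:-x, 1:]))"
      by (simp add: A(2) mult.assoc)
    then have "poly (pderiv p) x = 0"
      by (simp only: pderiv_mult poly_add poly_mult) simp
    then show False
      by (simp add: deriv)
  qed
  have "mset_set (set_mset A) = A"
    using count by (intro multiset_eqI) (simp add: count_mset_set' le_antisym not_in_iff)
  then have "card (set_mset A) = q"
    using A(1) by (metis size_mset_set)
  moreover have "x ^ q = x \<longleftrightarrow> x \<in># A" for x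
  proof -
    have "x ^ q = x \<longleftrightarrow> poly p x = 0"
      by (simp add: p_def poly_monom)
    also have "\<dots> \<longleftrightarrow> x \<in># A"
      by (auto simp: A(2) poly_prod_mset prod_mset_zero_iff)
    finally show ?thesis .
  qed
  ultimately show ?thesis
    by simp
qed

lemma CHAR_bit: "CHAR(bit) = 2"
  by (rule CHAR_eq_posI) (auto simp: less_Suc_eq numeral_2_eq_2)

text \<open>In characteristic 2, raising to the power \<open>2 ^ n\<close> respects sums and
  products, so its fixed points are closed under both. These closure properties keep
  \<open>a * x + y\<close> in \<open>K\<close>.\<close>

lemma ex_finite_subsemiring_alg_closure_bit:
  assumes "n > 0"
  obtains K :: "bit alg_closure set" where "card K = 2 ^ n"
    "\<And>x y. x \<in> K \<Longrightarrow> y \<in> K \<Longrightarrow> x + y \<in> K" "\<And>x y. x \<in> K \<Longrightarrow> y \<in> K \<Longrightarrow> x * y \<in> K"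
proof
  let ?K = "{x :: bit alg_closure. x ^ (2 ^ n) = x}"
  show "card ?K = 2 ^ n"
    using card_frobenius_fixed_points[where 'a = "bit alg_closure"] assms by (simp add: CHAR_bit)
  show "x + y \<in> ?K" if "x \<in> ?K" "y \<in> ?K" for x y
    using that freshmans_dream'[where 'a = "bit alg_closure", of "2 ^ n" n x y] by (simp add: CHAR_bit)
  show "x * y \<in> ?K" if "x \<in> ?K" "y \<in> ?K" for x y
    using that by (simp add: power_mult_distrib)
qed

text \<open>\<open>Inl (x, z)\<close> is a point and \<open>Inr (a, y)\<close> is the line with
  slope \<open>a\<close> and intercept \<open>y\<close>; the edges are the incidences. Two distinct
  points share at most one line, so there is no four-cycle.\<close>

lemma affine_plane_K22_free:
  fixes K :: "'a::idom set"
  assumes "finite K" "\<And>x y. x \<in> K \<Longrightarrow> y \<in> K \<Longrightarrow> x + y \<in> K" "\<And>x y. x \<in> K \<Longrightarrow> y \<in> K \<Longrightarrow> x * y \<in> K"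
  defines "V \<equiv> K \<times> K <+> K \<times> K"
  defines "E \<equiv> (\<lambda>(a, x, y). {Inl (x, a * x + y), Inr (a, y)}) ` (K \<times> K \<times> K)"
  shows "uniform_hypergraph 2 (V, E)" "\<not> embeds (complete_bipartite 2 2) (V, E)"
    "card V = 2 * card K ^ 2" "card E = card K ^ 3"
proof -
  show uniform: "uniform_hypergraph 2 (V, E)"
    using assms(1-3) by (auto simp: uniform_hypergraph_def V_def E_def)
  define inc where "inc p l \<longleftrightarrow> snd p = fst l * fst p + snd l" for p l :: "'a \<times> 'a"
  \<comment> \<open>Subtracting the four incidence equations makes the product of the slope and
    abscissa differences vanish. Equal slopes force equal lines, and equal abscissas force equal
    points.\<close>
  have two_points: False
    if "inc p l" "inc p' l" "inc p l'" "inc p' l'" "p \<noteq> p'" "l \<noteq> l'" for p p' l l'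
  proof -
    have "(fst l - fst l') * (fst p - fst p') =
        (fst l * fst p + snd l) - (fst l * fst p' + snd l) -
        ((fst l' * fst p + snd l') - (fst l' * fst p' + snd l'))"
      by (simp add: algebra_simps)
    also have "\<dots> = 0"
      using that(1-4) by (simp add: inc_def)
    finally have "fst l = fst l' \<or> fst p = fst p'" by simp
    then show False using that by (auto simp: inc_def prod_eq_iff)
  qed
  have edge: "(\<exists>p l. u = Inl p \<and> v = Inr l \<and> inc p l) \<or> (\<exists>p l. u = Inr l \<and> v = Inl p \<and> inc p l)"
    if "{u, v} \<in> E" for u v
    using that by (auto simp: E_def inc_def doubleton_eq_iff)
  show "\<not> embeds (complete_bipartite 2 2) (V, E)"
  proof
    assume "embeds (complete_bipartite 2 2) (V, E)"
    then obtain u v w z where uv: "u \<noteq> v" "w \<noteq> z"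
      and edges: "{u, w} \<in> E" "{u, z} \<in> E" "{v, w} \<in> E" "{v, z} \<in> E"
      unfolding embeds_K22_iff[OF uniform] by auto
    \<comment> \<open>Edges join points to lines, so \<open>u\<close> and \<open>v\<close> are on
      one side and \<open>w\<close> and \<open>z\<close> on the other; either way two distinct
      points lie on two distinct lines.\<close>
    show False
    proof (cases u)
      case (Inl p)
      then obtain l l' where l: "w = Inr l" "inc p l" "z = Inr l'" "inc p l'"
        using edge[OF edges(1)] edge[OF edges(2)] by auto
      then obtain p' where "v = Inl p'" "inc p' l" "inc p' l'"
        using edge[OF edges(3)] edge[OF edges(4)] by auto
      then show False using two_points[of p l p' l'] uv l Inl by auto
    next
      case (Inr l)
      then obtain p p' where p: "w = Inl p" "inc p l" "z = Inl p'" "inc p' l"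
        using edge[OF edges(1)] edge[OF edges(2)] by auto
      then obtain l' where "v = Inr l'" "inc p l'" "inc p' l'"
        using edge[OF edges(3)] edge[OF edges(4)] by auto
      then show False using two_points[of p l p' l'] uv p Inr by auto
    qed
  qed
  show "card V = 2 * card K ^ 2"
    using assms(1) by (simp add: V_def card_Plus power2_eq_square)
  \<comment> \<open>Slope, abscissa and intercept can be read off from the edge.\<close>
  have "inj_on (\<lambda>(a, x, y). {Inl (x, a * x + y), Inr (a, y)}) (K \<times> K \<times> K)"
    by (auto simp: inj_on_def doubleton_eq_iff)
  then show "card E = card K ^ 3"
    by (simp add: E_def card_image card_cartesian_product power3_eq_cube)
qed

section \<open>Order of growth of the extremal number\<close>

lemma ex_graph_K22_upper: "ex_graph m (complete_bipartite 2 2) ^ 2 \<le> 3 * m ^ 3"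
proof -
  obtain E where "uniform_hypergraph 2 ({..<m}, E)" "\<not> embeds (complete_bipartite 2 2) ({..<m}, E)"
    "card E = ex_graph m (complete_bipartite 2 2)"
    using ex_hyper_attained[OF edges_complete_bipartite complete_bipartite_has_edge[OF pos2 pos2]]
    unfolding ex_graph_def by blast
  then show ?thesis
    using K22_free_card_bound[of "{..<m}" E] by simp
qed

text \<open>For \<open>q = 2 ^ n\<close> the plane has \<open>2 * q ^ 2\<close> vertices and
  \<open>q ^ 3\<close> edges. Taking the largest \<open>n\<close> that fits gives
  \<open>m < 8 * q ^ 2\<close>, hence \<open>m ^ 3 \<le> 8 ^ 3 * q ^ 6\<close>, and
  \<open>8 ^ 3 = 2 ^ 9\<close>.\<close>

lemma ex_graph_K22_lower:
  assumes "m \<ge> 8"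
  shows "m ^ 3 \<le> 2 ^ 9 * ex_graph m (complete_bipartite 2 2) ^ 2"
proof -
  have "1 \<le> m div 2"
    using assms by linarith
  then obtain n where "4 ^ n \<le> m div 2" "m div 2 < 4 ^ (n + 1)"
    using ex_power_ivl1[of 4 "m div 2"] by auto
  \<comment> \<open>\<open>m \<ge> 8\<close> excludes \<open>n = 0\<close>, for which the upper
    bound would read \<open>m < 8\<close>.\<close>
  then have n: "2 * 4 ^ n \<le> m" "m < 2 * 4 ^ Suc n" "n > 0"
    using assms by (auto intro: gr0I)
  obtain K :: "bit alg_closure set" where K: "card K = 2 ^ n"
    "\<And>x y. x \<in> K \<Longrightarrow> y \<in> K \<Longrightarrow> x + y \<in> K" "\<And>x y. x \<in> K \<Longrightarrow> y \<in> K \<Longrightarrow> x * y \<in> K"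
    using ex_finite_subsemiring_alg_closure_bit[OF n(3)] by blast
  have "finite K"
    using K(1) by (metis card.infinite power_not_zero zero_neq_numeral)
  note plane = affine_plane_K22_free[OF this K(2,3)]
  have "(2::nat) ^ (2 * n) = 4 ^ n"
    by (simp add: power_mult)
  then have "2 * card K ^ 2 \<le> m"
    using n(1) by (simp add: K(1) mult.commute flip: power_mult)
  then have "card K ^ 3 \<le> ex_graph m (complete_bipartite 2 2)"
    using card_le_ex_hyper_of_card_le[OF edges_complete_bipartite
        vertices_complete_bipartite[of 2 2] plane(1,2), of m]
    by (simp add: ex_graph_def plane(3,4))
  then have "(card K ^ 3) ^ 2 \<le> ex_graph m (complete_bipartite 2 2) ^ 2"
    by (rule power_mono) simp
  moreover have "m ^ 3 \<le> (8 * card K ^ 2) ^ 3"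
    using n(2) \<open>(2::nat) ^ (2 * n) = 4 ^ n\<close>
    by (intro power_mono) (simp_all add: K(1) mult.commute flip: power_mult)
  moreover have "(8 * card K ^ 2) ^ 3 = 2 ^ 9 * (card K ^ 3) ^ 2"
    by (simp add: power_mult_distrib flip: power_mult)
  ultimately show ?thesis
    by (metis le_trans mult_le_mono2)
qed

text \<open>Both bounds on the extremal number are compared after squaring, with
  \<open>3 \<le> 2 ^ 2\<close> and \<open>2 ^ 9 \<le> 32 ^ 2\<close>. The terms \<open>1\<close> and
  \<open>m\<close> are each at most \<open>m powr (3/2)\<close> for \<open>m \<ge> 1\<close>, which
  raises the upper constant from 2 to 4.\<close>

lemma ex_graph_K22_bigtheta:
  "(\<lambda>m. 1 + real m + real (ex_graph m (complete_bipartite 2 2))) \<in> \<Theta>(\<lambda>m. real m powr (3/2))"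
proof -
  let ?e = "\<lambda>m. ex_graph m (complete_bipartite 2 2)"
  have powr: "(real m powr (3/2)) ^ 2 = real m ^ 3" for m
    by (cases "m = 0") (simp_all add: powr_power powr_numeral)
  have upper: "real (?e m) \<le> 2 * real m powr (3/2)" for m
  proof (rule power2_le_imp_le)
    have "real (?e m ^ 2) \<le> real (3 * m ^ 3)"
      using ex_graph_K22_upper[of m] by (simp only: of_nat_le_iff)
    also have "\<dots> \<le> 4 * real m ^ 3" by simp
    finally show "(real (?e m))\<^sup>2 \<le> (2 * real m powr (3/2))\<^sup>2"
      by (simp add: power_mult_distrib powr)
  qed simp
  have lower: "real m powr (3/2) \<le> 32 * real (?e m)" if "m \<ge> 8" for m
  proof (rule power2_le_imp_le)
    have "real (m ^ 3) \<le> real (2 ^ 9 * ?e m ^ 2)"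
      using ex_graph_K22_lower[OF that] by (simp only: of_nat_le_iff)
    also have "\<dots> \<le> 32 ^ 2 * real (?e m) ^ 2" by simp
    finally show "(real m powr (3/2))\<^sup>2 \<le> (32 * real (?e m))\<^sup>2"
      by (simp add: power_mult_distrib powr)
  qed simp
  have linear: "1 \<le> real m powr (3/2) \<and> real m \<le> real m powr (3/2)" if "m \<ge> 1" for m
    using that powr_mono[of 1 "3/2" "real m"] powr_mono[of 0 "3/2" "real m"] by simp
  have upper': "1 + real m + real (?e m) \<le> 4 * real m powr (3/2)" if "m \<ge> 1" for m
    using linear[OF that] upper[of m] by linarith
  have lower': "(1/32) * real m powr (3/2) \<le> 1 + real m + real (?e m)" if "m \<ge> 8" for m
    using lower[OF that] by linarith
  show ?thesis
  proof (rule bigthetaI)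
    show "(\<lambda>m. 1 + real m + real (?e m)) \<in> O(\<lambda>m. real m powr (3/2))"
      using upper' by (intro bigoI[of _ 4] eventually_sequentiallyI[of 1]) simp
    show "(\<lambda>m. 1 + real m + real (?e m)) \<in> \<Omega>(\<lambda>m. real m powr (3/2))"
      using lower' by (intro landau_omega.bigI[of "1/32"] eventually_sequentiallyI[of 8]) simp_all
  qed
qed

theorem corollary5p3:
  shows "(\<forall>(k::nat) (s::nat list) (m::nat).
            k \<ge> 2 \<longrightarrow> length s = k - 1 \<longrightarrow> (\<forall>x\<in>set s. x > 0) \<longrightarrow>
            forb m {ones_mat k 1, mat_product_list (map (\<lambda>x. 1\<^sub>m x) s)} =
              (\<Sum>i=0..k-2. m choose i) + ex_hyper (k - 1) m (complete_multipartite s))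
       \<and> (\<forall>m::nat. forb m {ones_mat 3 1, F11} = 1 + m + ex_graph m (complete_bipartite 2 2))
       \<and> (\<lambda>m::nat. real (forb m {ones_mat 3 1, F11})) \<in> \<Theta>(\<lambda>m. real m powr (3/2))"
proof (intro conjI allI impI)
  fix k m :: nat and s :: "nat list"
  assume k: "k \<ge> 2" "length s = k - 1" and s: "\<forall>x\<in>set s. x > 0"
  \<comment> \<open>\<open>k \<ge> 2\<close> matters for the truncated subtraction: only then does
    \<open>{0..k - 2}\<close> have \<open>k - 1\<close> elements.\<close>
  have "{0..k - 2} = {..<length s}"
    using k by auto
  moreover have "k = Suc (length s)"
    using k by simp
  ultimately show "forb m {ones_mat k 1, mat_product_list (map (\<lambda>x. 1\<^sub>m x) s)} =
      (\<Sum>i=0..k-2. m choose i) + ex_hyper (k - 1) m (complete_multipartite s)"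
    using forb_complete_multipartite[OF s, of m] by simp
next
  show "(\<lambda>m. real (forb m {ones_mat 3 1, F11})) \<in> \<Theta>(\<lambda>m. real m powr (3/2))"
    using ex_graph_K22_bigtheta unfolding forb_F11 by (simp add: add.assoc)
qed (rule forb_F11)

end
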